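(* For $w\in\mathbb{R}^n$ define $$\Lambda_n(w)=|w|^2\int_{(\mathbb{R}^n)^n}\delta\Big[1+\sum_{k=1}^{n-1}|x_k|^2-|x_n|^2\Big]\,\delta\Big(w-\sum_{k=1}^n x_k\Big)\prod_{k=1}^n|x_k|^{-(n-1)}\,dx_1\cdots dx_n ,$$ $$\Delta_n(w)=|w|^{n-1}\int_{\mathbb{R}^n\times\mathbb{R}^n\times\mathbb{R}^n}\delta\big[1+|z|^2+|x|^2-|y|^2\big]\,\delta(w-x-y-z)\,\big[|x|\,|y|\,|z|\big]^{-(n-1)}\,dx\,dy\,dz .$$ Then: (i) for every integer $n\ge 3$, $\Lambda_n$ is bounded, i.e. $\sup_{w\in\mathbb{R}^n}\Lambda_n(w)<\infty$; (ii) for every integer $n\ge 2$, $\Delta_n$ is bounded, i.e. $\sup_{w\in\mathbb{R}^n}\Delta_n(w)<\infty$.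
   Context: Here $|\cdot|$ is the Euclidean norm, and each $x_k$ (and $x,y,z$) ranges over $\mathbb{R}^n$. All integrals have nonnegative integrands and take values in $[0,\infty]$, with the usual convention $0\cdot\infty=0$. Meaning of the delta functions: the vector-valued delta $\delta(w-\sum x_k)$ is the Dirac delta on $\mathbb{R}^n$; it means that one of the variables is eliminated by substituting from the linear constraint (e.g. $x_{n-1}=w-\sum_{k\ne n-1}x_k$) and that one integrates with Lebesgue measure over the remaining variables (the result does not depend on which variable is eliminated). The scalar delta is the Dirac delta on $\mathbb{R}$ composed with a smooth function $F$ of the remaining variables whose gradient does not vanish on $\{F=0\}$: $\int \delta[F(X)]\,g(X)\,dX=\int_{\{F=0\}} g\,\frac{d\mathcal{H}}{|\nabla F|}$, where $\mathcal{H}$ is the surface measure (Hausdorff measure of codimension one) on $\{F=0\}$. *)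

theory Defs
  imports "HOL-Analysis.Analysis"
begin

section \<open>Hausdorff measure\<close>

text \<open>The factor \<open>unit_ball_vol d / 2 ^ d\<close> is the normalization for which the \<open>d\<close>-dimensional
  Hausdorff measure of a smooth \<open>d\<close>-dimensional surface is its surface area. The empty set is
  treated separately because \<open>0 ^ 0 = 1\<close>.\<close>

definition hausdorff_gauge :: "nat \<Rightarrow> 'a::metric_space set \<Rightarrow> ennreal" where
  "hausdorff_gauge d U =
     (if U = {} then 0 else ennreal (unit_ball_vol (real d) * (diameter U / 2) ^ d))"

text \<open>Boundedness is required explicitly since \<^const>\<open>diameter\<close> is unspecified on unbounded sets.\<close>

definition hausdorff_covers :: "real \<Rightarrow> 'a::metric_space set \<Rightarrow> (nat \<Rightarrow> 'a set) set" where
  "hausdorff_covers \<delta> A =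
     {U. A \<subseteq> (\<Union>i. U i) \<and> (\<forall>i. bounded (U i) \<and> diameter (U i) \<le> \<delta>)}"

definition hausdorff_content :: "nat \<Rightarrow> real \<Rightarrow> 'a::metric_space set \<Rightarrow> ennreal" where
  "hausdorff_content d \<delta> A = (INF U \<in> hausdorff_covers \<delta> A. \<Sum>i. hausdorff_gauge d (U i))"

definition hausdorff_outer :: "nat \<Rightarrow> 'a::metric_space set \<Rightarrow> ennreal" where
  "hausdorff_outer d A = (SUP \<delta> \<in> {0<..}. hausdorff_content d \<delta> A)"

definition hausdorff_measure :: "nat \<Rightarrow> 'a::metric_space measure" where
  "hausdorff_measure d = measure_of UNIV (sets borel) (hausdorff_outer d)"

text \<open>The lemmas of this section justify the use of \<^const>\<open>measure_of\<close>, which would yield the zero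
  measure if its argument were not countably additive: \<^const>\<open>hausdorff_outer\<close> is a metric outer
  measure, hence countably additive on the Borel sets (Caratheodory's criterion).\<close>

lemma hausdorff_content_mono: "A \<subseteq> B \<Longrightarrow> hausdorff_content d \<delta> A \<le> hausdorff_content d \<delta> B"
  unfolding hausdorff_content_def by (rule INF_superset_mono) (auto simp: hausdorff_covers_def)

lemma hausdorff_content_antimono:
  "\<delta> \<le> \<delta>' \<Longrightarrow> hausdorff_content d \<delta>' A \<le> hausdorff_content d \<delta> A"
  unfolding hausdorff_content_def
  by (rule INF_superset_mono) (auto simp: hausdorff_covers_def intro: order_trans)

lemma hausdorff_outer_mono: "A \<subseteq> B \<Longrightarrow> hausdorff_outer d A \<le> hausdorff_outer d B"
  unfolding hausdorff_outer_def by (intro SUP_mono' hausdorff_content_mono)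

lemma hausdorff_content_le_outer: "0 < \<delta> \<Longrightarrow> hausdorff_content d \<delta> A \<le> hausdorff_outer d A"
  unfolding hausdorff_outer_def by (rule SUP_upper) auto

lemma hausdorff_outer_empty: "hausdorff_outer d {} = 0"
proof -
  have "hausdorff_content d \<delta> {} = 0" if "\<delta> > 0" for \<delta>
    unfolding hausdorff_content_def
    by (rule antisym, rule INF_lower2[of "\<lambda>_. {}"])
       (use that in \<open>auto simp: hausdorff_covers_def hausdorff_gauge_def\<close>)
  then show ?thesis
    unfolding hausdorff_outer_def by (auto simp: bot_ennreal[symmetric] intro!: SUP_eq_const)
qed

lemma hausdorff_content_UN:
  "hausdorff_content d \<delta> (\<Union>i. A i) \<le> (\<Sum>i. hausdorff_content d \<delta> (A i))"
proof (rule ennreal_le_epsilon)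
  fix e :: real
  assume e: "0 < e" and fin: "(\<Sum>n. hausdorff_content d \<delta> (A n)) < top"
  have "hausdorff_content d \<delta> (A n) < hausdorff_content d \<delta> (A n) + ennreal (e * (1/2) ^ Suc n)" for n
    using e fin by (auto simp: less_top dest!: ennreal_suminf_lessD)
  then have "\<exists>U \<in> hausdorff_covers \<delta> (A n).
      (\<Sum>i. hausdorff_gauge d (U i)) < hausdorff_content d \<delta> (A n) + ennreal (e * (1/2) ^ Suc n)" for n
    by (subst (asm) (1) hausdorff_content_def) (simp add: INF_less_iff)
  then obtain B where B: "\<And>n. B n \<in> hausdorff_covers \<delta> (A n)"
    and Ble: "\<And>n. (\<Sum>i. hausdorff_gauge d (B n i))
      \<le> hausdorff_content d \<delta> (A n) + ennreal (e * (1/2) ^ Suc n)"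
    by (metis less_imp_le)
  define C where "C = case_prod B \<circ> prod_decode"
  have "(\<Union>i. A i) \<subseteq> (\<Union>i. C i)"
  proof
    fix x assume "x \<in> (\<Union>i. A i)"
    then obtain n i where "x \<in> B n i"
      using B by (auto simp: hausdorff_covers_def) blast
    then show "x \<in> (\<Union>i. C i)"
      by (auto simp: C_def intro!: exI[of _ "prod_encode (n, i)"])
  qed
  then have "C \<in> hausdorff_covers \<delta> (\<Union>i. A i)"
    using B by (auto simp: hausdorff_covers_def C_def split_def)
  then have "hausdorff_content d \<delta> (\<Union>i. A i) \<le> (\<Sum>i. hausdorff_gauge d (C i))"
    unfolding hausdorff_content_def by (rule INF_lower)
  also have "\<dots> = (\<Sum>i. (\<lambda>p. hausdorff_gauge d (case_prod B p)) (prod_decode i))"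
    by (simp add: C_def)
  also have "\<dots> = (\<Sum>n. \<Sum>i. hausdorff_gauge d (B n i))"
    by (rule suminf_ennreal_2dimen) simp
  also have "\<dots> \<le> (\<Sum>n. hausdorff_content d \<delta> (A n) + ennreal (e * (1/2) ^ Suc n))"
    by (intro suminf_le allI Ble) auto
  also have "\<dots> = (\<Sum>n. hausdorff_content d \<delta> (A n)) + (\<Sum>n. ennreal e * ennreal ((1/2) ^ Suc n))"
    using e by (subst suminf_add[symmetric])
               (auto simp del: ennreal_suminf_cmult simp add: ennreal_mult[symmetric])
  also have "\<dots> = (\<Sum>n. hausdorff_content d \<delta> (A n)) + e"
    unfolding ennreal_suminf_cmult
    by (subst suminf_ennreal_eq[OF zero_le_power power_half_series]) auto
  finally show "hausdorff_content d \<delta> (\<Union>i. A i) \<le> (\<Sum>n. hausdorff_content d \<delta> (A n)) + e" .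
qed

lemma hausdorff_outer_UN: "hausdorff_outer d (\<Union>i. A i) \<le> (\<Sum>i. hausdorff_outer d (A i))"
  unfolding hausdorff_outer_def[of _ "\<Union>i. A i"]
proof (rule SUP_least)
  fix \<delta> :: real assume "\<delta> \<in> {0<..}"
  then have "(\<Sum>i. hausdorff_content d \<delta> (A i)) \<le> (\<Sum>i. hausdorff_outer d (A i))"
    by (intro suminf_le allI hausdorff_content_le_outer) auto
  with hausdorff_content_UN show "hausdorff_content d \<delta> (\<Union>i. A i) \<le> (\<Sum>i. hausdorff_outer d (A i))"
    by (rule order_trans)
qed

lemma hausdorff_outer_space: "outer_measure_space UNIV (hausdorff_outer d)"
  by (auto simp: outer_measure_space_def positive_def increasing_def countably_subadditive_def
      hausdorff_outer_empty hausdorff_outer_mono hausdorff_outer_UN)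

lemma hausdorff_outer_Un: "hausdorff_outer d (A \<union> B) \<le> hausdorff_outer d A + hausdorff_outer d B"
proof -
  interpret sigma_algebra "UNIV :: 'a set" UNIV
    using sigma_algebra_Pow[of UNIV] by simp
  show ?thesis
    using countably_subadditive_subadditive[of "hausdorff_outer d"] hausdorff_outer_space[of d]
      hausdorff_outer_UN[of d "binaryset A B"] suminf_binaryset_eq[of "hausdorff_outer d" A B]
    by (simp add: UN_binaryset_eq hausdorff_outer_empty)
qed

lemma hausdorff_content_separated:
  assumes r: "\<delta> < r" and sep: "\<And>a b. a \<in> A \<Longrightarrow> b \<in> B \<Longrightarrow> r \<le> dist a b" and "\<delta> > 0"
  shows "hausdorff_content d \<delta> A + hausdorff_content d \<delta> B \<le> hausdorff_content d \<delta> (A \<union> B)"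
  unfolding hausdorff_content_def[of _ _ "A \<union> B"]
proof (rule INF_greatest)
  fix U assume U: "U \<in> hausdorff_covers \<delta> (A \<union> B)"
  define V where "V i = (if U i \<inter> A = {} then {} else U i)" for i
  define W where "W i = (if U i \<inter> A = {} then U i else {})" for i
  have "A \<subseteq> (\<Union>i. V i)"
    using U unfolding hausdorff_covers_def V_def by fastforce
  moreover have "B \<subseteq> (\<Union>i. W i)"
  proof
    fix b assume b: "b \<in> B"
    then obtain i where i: "b \<in> U i"
      using U by (auto simp: hausdorff_covers_def)
    have "a \<notin> A" if "a \<in> U i" for a
    proof
      assume "a \<in> A"
      have "dist a b \<le> diameter (U i)"
        using U that i by (intro diameter_bounded_bound) (auto simp: hausdorff_covers_def)
      also have "\<dots> \<le> \<delta>"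
        using U by (auto simp: hausdorff_covers_def)
      finally show False
        using sep[OF \<open>a \<in> A\<close> b] r by simp
    qed
    then have "b \<in> W i"
      using i by (auto simp: W_def)
    then show "b \<in> (\<Union>i. W i)"
      by blast
  qed
  ultimately have "V \<in> hausdorff_covers \<delta> A" "W \<in> hausdorff_covers \<delta> B"
    using U \<open>\<delta> > 0\<close> by (auto simp: hausdorff_covers_def V_def W_def)
  then have "hausdorff_content d \<delta> A + hausdorff_content d \<delta> B
      \<le> (\<Sum>i. hausdorff_gauge d (V i)) + (\<Sum>i. hausdorff_gauge d (W i))"
    unfolding hausdorff_content_def by (intro add_mono INF_lower)
  also have "\<dots> = (\<Sum>i. hausdorff_gauge d (V i) + hausdorff_gauge d (W i))"
    by (rule suminf_add) auto
  also have "\<dots> = (\<Sum>i. hausdorff_gauge d (U i))"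
    by (intro arg_cong[where f = suminf] ext) (auto simp: V_def W_def hausdorff_gauge_def)
  finally show "hausdorff_content d \<delta> A + hausdorff_content d \<delta> B \<le> (\<Sum>i. hausdorff_gauge d (U i))" .
qed

lemma hausdorff_outer_separated:
  assumes "r > 0" and sep: "\<And>a b. a \<in> A \<Longrightarrow> b \<in> B \<Longrightarrow> r \<le> dist a b"
  shows "hausdorff_outer d A + hausdorff_outer d B \<le> hausdorff_outer d (A \<union> B)"
proof -
  have *: "hausdorff_content d \<delta> A + hausdorff_content d \<epsilon> B \<le> hausdorff_outer d (A \<union> B)"
    if "\<delta> > 0" "\<epsilon> > 0" for \<delta> \<epsilon>
  proof -
    define \<eta> where "\<eta> = min (min \<delta> \<epsilon>) (r / 2)"
    have \<eta>: "0 < \<eta>" "\<eta> < r" "\<eta> \<le> \<delta>" "\<eta> \<le> \<epsilon>"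
      using that \<open>r > 0\<close> by (auto simp: \<eta>_def)
    have "hausdorff_content d \<delta> A + hausdorff_content d \<epsilon> B
        \<le> hausdorff_content d \<eta> A + hausdorff_content d \<eta> B"
      using \<eta> by (intro add_mono hausdorff_content_antimono)
    also have "\<dots> \<le> hausdorff_content d \<eta> (A \<union> B)"
      using \<eta> sep by (intro hausdorff_content_separated)
    also have "\<dots> \<le> hausdorff_outer d (A \<union> B)"
      using \<eta> by (intro hausdorff_content_le_outer)
    finally show ?thesis .
  qed
  show ?thesis
    unfolding hausdorff_outer_def[of d A] hausdorff_outer_def[of d B]
    by (subst ennreal_SUP_add_left[symmetric], simp, rule SUP_least,
        subst ennreal_SUP_add_right, simp, rule SUP_least) (use * in auto)
qed

lemma hausdorff_outer_closed:
  fixes C :: "'a::metric_space set"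
  assumes "closed C"
  shows "hausdorff_outer d (A \<inter> C) + hausdorff_outer d (A - C) \<le> hausdorff_outer d A"
proof (cases "C = {} \<or> hausdorff_outer d A = top")
  case True
  then show ?thesis
    by (auto simp: hausdorff_outer_empty)
next
  case False
  then have ne: "C \<noteq> {}" and fin: "hausdorff_outer d A < top"
    by (auto simp: less_top)
  let ?H = "hausdorff_outer d :: 'a set \<Rightarrow> ennreal"
  define D where "D k = {x \<in> A. 1 / real (k + 1) \<le> infdist x C}" for k :: nat
  define R where "R k = D (Suc k) - D k" for k
  define P where "P = (SUP k. ?H (D k))"
  have dist_gap: "e - e' \<le> dist x y" if "e \<le> infdist x C" "infdist y C \<le> e'" for e e' :: real and x y
    using infdist_triangle[of x C y] that by linarith
  have sumR: "(\<Sum>j<N. ?H (R (2 * j + i))) \<le> ?H (\<Union>j<N. R (2 * j + i))" for N i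
  proof (induction N)
    case (Suc N)
    have sep: "1 / real (2 * N + i) - 1 / real (2 * N + i + 1) \<le> dist x y"
      if "x \<in> (\<Union>j<N. R (2 * j + i))" "y \<in> R (2 * N + i)" for x y
    proof (rule dist_gap)
      from that(1) obtain j where j: "j < N" "x \<in> R (2 * j + i)"
        by auto
      then have "1 / real (2 * N + i) \<le> 1 / real (2 * j + i + 2)"
        by (intro divide_left_mono) auto
      also have "\<dots> \<le> infdist x C"
        using j by (simp add: R_def D_def algebra_simps)
      finally show "1 / real (2 * N + i) \<le> infdist x C" .
      show "infdist y C \<le> 1 / real (2 * N + i + 1)"
        using that(2) by (auto simp: R_def D_def not_le)
    qed
    have "?H (\<Union>j<N. R (2 * j + i)) + ?H (R (2 * N + i))
        \<le> ?H ((\<Union>j<N. R (2 * j + i)) \<union> R (2 * N + i))"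
    proof (cases "N = 0")
      case False
      then have "0 < 1 / real (2 * N + i) - 1 / real (2 * N + i + 1)"
        by (simp add: frac_less2)
      then show ?thesis
        using sep by (rule hausdorff_outer_separated)
    qed (simp add: hausdorff_outer_empty)
    also have "(\<Union>j<N. R (2 * j + i)) \<union> R (2 * N + i) = (\<Union>j<Suc N. R (2 * j + i))"
      by (auto simp: less_Suc_eq)
    finally have "?H (\<Union>j<N. R (2 * j + i)) + ?H (R (2 * N + i)) \<le> ?H (\<Union>j<Suc N. R (2 * j + i))" .
    moreover have "(\<Sum>j<N. ?H (R (2 * j + i))) + ?H (R (2 * N + i))
        \<le> ?H (\<Union>j<N. R (2 * j + i)) + ?H (R (2 * N + i))"
      by (intro add_right_mono Suc.IH)
    ultimately show ?case
      unfolding sum.lessThan_Suc by (rule order_trans[rotated])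
  qed simp
  have R_le: "(\<Sum>j<N. ?H (R (2 * j + i))) \<le> ?H A" for N i
    by (rule order_trans[OF sumR hausdorff_outer_mono]) (auto simp: R_def D_def)
  have "(\<Sum>j<N. ?H (R j)) \<le> ?H A + ?H A" for N
  proof -
    have "(\<Sum>j<N. ?H (R j)) \<le> (\<Sum>j<2 * N. ?H (R j))"
      by (intro sum_mono2) auto
    also have "\<dots> = (\<Sum>j<N. ?H (R (2 * j + 0))) + (\<Sum>j<N. ?H (R (2 * j + 1)))"
      by (induction N) (auto simp: algebra_simps)
    also have "\<dots> \<le> ?H A + ?H A"
      by (intro add_mono R_le)
    finally show ?thesis .
  qed
  then have "(\<Sum>j. ?H (R j)) \<le> ?H A + ?H A"
    by (intro suminf_le_const summableI)
  then have S: "(\<Sum>j. ?H (R j)) < top"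
    using fin by (auto intro: le_less_trans simp: ennreal_add_less_top)
  have AC: "A - C \<subseteq> D k \<union> (\<Union>j. R (j + k))" for k
  proof
    fix x assume x: "x \<in> A - C"
    then have "infdist x C > 0"
      using in_closed_iff_infdist_zero[OF \<open>closed C\<close> ne, of x] infdist_nonneg[of x C] by auto
    then obtain m where m: "1 / real (m + 1) < infdist x C"
      using nat_approx_posE[of "infdist x C"] by auto
    define l where "l = (LEAST m. x \<in> D m)"
    have "x \<in> D m"
      using m x by (auto simp: D_def)
    then have l: "x \<in> D l" and least: "\<And>m. m < l \<Longrightarrow> x \<notin> D m"
      unfolding l_def by (auto intro: LeastI dest: not_less_Least)
    show "x \<in> D k \<union> (\<Union>j. R (j + k))"
    proof (cases "l \<le> k")
      case True
      then have "1 / real (k + 1) \<le> 1 / real (l + 1)"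
        by (intro divide_left_mono) auto
      then show ?thesis
        using l by (auto simp: D_def)
    next
      case False
      then have "x \<in> R ((l - 1 - k) + k)"
        using l least[of "l - 1"] by (simp add: R_def)
      then show ?thesis
        by blast
    qed
  qed
  have "?H (A - C) + (\<Sum>j<k. ?H (R j)) \<le> P + (\<Sum>j. ?H (R j))" for k
  proof -
    have "?H (A - C) \<le> ?H (D k \<union> (\<Union>j. R (j + k)))"
      using AC by (rule hausdorff_outer_mono)
    also have "\<dots> \<le> ?H (D k) + ?H (\<Union>j. R (j + k))"
      by (rule hausdorff_outer_Un)
    also have "\<dots> \<le> P + (\<Sum>j. ?H (R (j + k)))"
      unfolding P_def by (intro add_mono SUP_upper hausdorff_outer_UN) auto
    finally have "?H (A - C) + (\<Sum>j<k. ?H (R j)) \<le> P + (\<Sum>j. ?H (R (j + k))) + (\<Sum>j<k. ?H (R j))"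
      by (rule add_right_mono)
    also have "\<dots> = P + (\<Sum>j. ?H (R j))"
      using suminf_offset[of "\<lambda>j. ?H (R j)" k] by (simp add: add_ac)
    finally show ?thesis .
  qed
  then have "(\<Sum>j. ?H (R j)) + ?H (A - C) \<le> P + (\<Sum>j. ?H (R j))"
    by (intro ennreal_suminf_bound_add) (simp add: add.commute)
  then have "(\<Sum>j. ?H (R j)) + ?H (A - C) \<le> (\<Sum>j. ?H (R j)) + P"
    by (simp only: add.commute)
  then have "?H (A - C) \<le> P"
    using S by (subst (asm) ennreal_add_left_cancel_le) auto
  then have "?H (A \<inter> C) + ?H (A - C) \<le> ?H (A \<inter> C) + P"
    by (rule add_left_mono)
  also have "\<dots> = (SUP k. ?H (A \<inter> C) + ?H (D k))"
    unfolding P_def by (rule ennreal_SUP_add_right) simp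
  also have "\<dots> \<le> ?H A"
  proof (rule SUP_least)
    fix k
    have "?H (D k) + ?H (A \<inter> C) \<le> ?H (D k \<union> (A \<inter> C))"
    proof (rule hausdorff_outer_separated)
      show "1 / real (k + 1) \<le> dist x y" if "x \<in> D k" "y \<in> A \<inter> C" for x y
        using dist_gap[of "1 / real (k + 1)" x y 0] that by (auto simp: D_def)
    qed simp
    also have "\<dots> \<le> ?H A"
      by (rule hausdorff_outer_mono) (auto simp: D_def)
    finally show "?H (A \<inter> C) + ?H (D k) \<le> ?H A"
      by (simp add: add.commute)
  qed
  finally show ?thesis .
qed

lemma sets_hausdorff_measure [simp, measurable_cong]: "sets (hausdorff_measure d) = sets borel"
  by (simp add: hausdorff_measure_def sets.sigma_sets_eq[of borel, simplified])

lemma space_hausdorff_measure [simp]: "space (hausdorff_measure d) = UNIV"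
  by (simp add: hausdorff_measure_def)

theorem emeasure_hausdorff_measure:
  assumes "A \<in> sets borel"
  shows "emeasure (hausdorff_measure d) A = hausdorff_outer d A"
proof -
  let ?L = "lambda_system UNIV UNIV (hausdorff_outer d) :: 'a set set"
  interpret sigma_algebra "UNIV :: 'a set" UNIV
    using sigma_algebra_Pow[of UNIV] by simp
  have ms: "measure_space UNIV ?L (hausdorff_outer d)"
    by (rule caratheodory_lemma[OF hausdorff_outer_space])
  then interpret L: sigma_algebra UNIV ?L
    by (simp add: measure_space_def)
  have "C \<in> ?L" if "closed C" for C
    using hausdorff_outer_closed[OF that] hausdorff_outer_Un[of d "A \<inter> C" "A - C" for A]
    by (auto simp: lambda_system_eq Int_Diff_Un intro!: antisym)
  then have "sets borel \<subseteq> ?L"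
    by (auto simp: borel_eq_closed intro!: L.sigma_sets_subset)
  then have "positive (sets borel) (hausdorff_outer d :: 'a set \<Rightarrow> ennreal)"
    "countably_additive (sets borel) (hausdorff_outer d :: 'a set \<Rightarrow> ennreal)"
    using ms by (auto simp: measure_space_def positive_def countably_additive_def)
  then show ?thesis
    unfolding hausdorff_measure_def
    using assms sets.sigma_algebra_axioms[of "borel :: 'a measure"]
    by (intro emeasure_measure_of_sigma) auto
qed


section \<open>Dirac delta of a function\<close>

definition gradient :: "('a::real_inner \<Rightarrow> real) \<Rightarrow> 'a \<Rightarrow> 'a" where
  "gradient F X = (THE D. GDERIV F X :> D)"

lemma gradient_eq:
  assumes "GDERIV F X :> D"
  shows "gradient F X = D"
  unfolding gradient_def
proof (rule the_equality)
  show "GDERIV F X :> D"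
    by (fact assms)
  fix E assume "GDERIV F X :> E"
  with assms have "(\<lambda>h. inner h E) = (\<lambda>h. inner h D)"
    unfolding gderiv_def by (rule has_derivative_unique[rotated])
  then show "E = D"
    by (simp add: fun_eq_iff vector_eq_ldot)
qed

text \<open>\<open>\<integral> \<delta>[F(X)] g(X) dX\<close>, for smooth \<open>F\<close> whose gradient does not vanish on \<open>{F = 0}\<close>\<close>

definition delta_integral ::
  "('a::euclidean_space \<Rightarrow> real) \<Rightarrow> ('a \<Rightarrow> ennreal) \<Rightarrow> ennreal" where
  "delta_integral F g =
     (\<integral>\<^sup>+ X \<in> {X. F X = 0}. g X / ennreal (norm (gradient F X)) \<partial>hausdorff_measure (DIM('a) - 1))"


section \<open>The functions \<open>\<Lambda>\<^sub>n\<close> and \<open>\<Delta>\<^sub>n\<close>\<close>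

text \<open>\<open>|x|\<close> to the power \<open>-(n - 1)\<close>, with value \<open>\<infinity>\<close> at \<open>x = 0\<close>\<close>

definition weight :: "real ^ 'n \<Rightarrow> ennreal" where
  "weight x = inverse (ennreal (norm x) ^ (CARD('n) - 1))"

text \<open>Here \<open>n = CARD('n)\<close>. In both integrals the vector-valued delta function is resolved by
  substituting for the variable carrying the minus sign in the quadratic form: \<open>x\<^sub>n\<close> in \<open>\<Lambda>\<^sub>n\<close> and
  \<open>y\<close> in \<open>\<Delta>\<^sub>n\<close>. The remaining variables \<open>x\<^sub>1, \<dots>, x\<^sub>n\<^sub>-\<^sub>1\<close> of \<open>\<Lambda>\<^sub>n\<close> are the components of
  \<open>X :: real ^ 'n ^ 'm\<close>, so \<open>Lambda TYPE('m)\<close> is \<open>\<Lambda>\<^sub>n\<close> only if \<open>CARD('m) = n - 1\<close>.\<close>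

definition Lambda :: "'m::finite itself \<Rightarrow> real ^ 'n \<Rightarrow> ennreal" where
  "Lambda (_ :: 'm itself) w =
     ennreal (norm w ^ 2) *
     delta_integral
       (\<lambda>X :: real ^ 'n ^ 'm. 1 + (\<Sum>k\<in>UNIV. norm (X $ k) ^ 2) - norm (w - (\<Sum>k\<in>UNIV. X $ k)) ^ 2)
       (\<lambda>X. (\<Prod>k\<in>UNIV. weight (X $ k)) * weight (w - (\<Sum>k\<in>UNIV. X $ k)))"

definition Delta :: "real ^ 'n \<Rightarrow> ennreal" where
  "Delta w =
     ennreal (norm w ^ (CARD('n) - 1)) *
     delta_integral
       (\<lambda>(x :: real ^ 'n, z :: real ^ 'n). 1 + norm z ^ 2 + norm x ^ 2 - norm (w - x - z) ^ 2)
       (\<lambda>(x, z). weight x * weight (w - x - z) * weight z)"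

end

theory Submission
  imports Defs
begin

text \<open>Both integrals are instances of one family: \<open>m\<close> free vectors \<open>x\<^sub>1, \<dots>, x\<^sub>m\<close> of \<open>\<real>\<^sup>n\<close>, where
  \<open>2 \<le> m \<le> n\<close>, the constraint \<open>F = 1 + \<Sum>|x\<^sub>k|\<^sup>2 - |w - \<Sum>x\<^sub>k|\<^sup>2 = 0\<close> and the prefactor \<open>|w|\<close> to the power
  \<open>n + 1 - m\<close>; here \<open>m = n - 1\<close> gives \<open>\<Lambda>\<^sub>n\<close> and \<open>m = 2\<close> gives \<open>\<Delta>\<^sub>n\<close>. Since \<open>F\<close> is affine in each single
  coordinate, the part of \<open>{F = 0}\<close> where a given partial derivative is the largest is a graph with a
  universal Lipschitz constant, and the delta integral is dominated by Lebesgue integrals over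
  coordinate hyperplanes.

  As a function of one block \<open>z = x\<^sub>k\<close> the constraint describes the hyperplane \<open>2 p \<bullet> z = |p|\<^sup>2 - Q\<close>, where
  \<open>p = w - \<Sum>x\<^sub>j\<close> and \<open>Q = 1 + \<Sum>|x\<^sub>j|\<^sup>2\<close> with \<open>j \<noteq> k\<close>. The origin and \<open>p\<close> have the same orthogonal projection
  to it, and their distances to it are \<open>||p|\<^sup>2 - Q|/2|p|\<close> and \<open>(|p|\<^sup>2 + Q)/2|p|\<close>. Integrating out \<open>z\<close> leaves
  \<open>||p|\<^sup>2 - Q|\<close> to a small negative power \<open>-\<epsilon>\<close> times \<open>|p|\<^sup>2 + Q\<close> to the power \<open>\<epsilon> - n/2\<close>. The first factor is a
  negative power of a function affine in a second block, with slope \<open>-2(w - \<Sum>x\<^sub>j)\<close> over the remaining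
  indices, hence integrable; the second is at most a product of one-variable powers. Powers of
  Euclidean norms are replaced throughout by products over the coordinates, so that only one-variable
  integrals have to be computed, and the exponents balance to the power \<open>-(n + 1 - m)\<close> of \<open>|w|\<close>.\<close>

section \<open>Hausdorff measure of Lipschitz graphs\<close>

text \<open>With \<open>t = 0\<close> and \<open>e\<close> in the basis this is the orthogonal
  projection along \<open>e\<close>. Varying \<open>t\<close> over the unit interval thickens a
  graph over the hyperplane to a cylinder of positive Lebesgue measure.\<close>

definition set_coord :: "'a::euclidean_space \<Rightarrow> real \<Rightarrow> 'a \<Rightarrow> 'a" where
  "set_coord e t X = X + (t - X \<bullet> e) *\<^sub>R e"

lemma set_coord_inner_same [simp]: "e \<in> Basis \<Longrightarrow> set_coord e t X \<bullet> e = t"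
  by (simp add: set_coord_def inner_simps)

lemma set_coord_inner_other: "\<lbrakk>e \<in> Basis; b \<in> Basis; b \<noteq> e\<rbrakk> \<Longrightarrow> set_coord e t X \<bullet> b = X \<bullet> b"
  by (simp add: set_coord_def inner_simps inner_not_same_Basis)

lemma set_coord_diff: "set_coord e t X - set_coord e t Y = set_coord e 0 (X - Y)"
  by (simp add: set_coord_def algebra_simps inner_simps)

text \<open>The definition uses sequences of sets; a countable family becomes one by padding with
  empty sets, whose gauge is 0 even for \<open>d = 0\<close>. Writing the sum as an integral over
  \<open>count_space I\<close> lets it be interchanged with a Lebesgue integral.\<close>

lemma hausdorff_content_le_countable:
  assumes "countable I" "0 \<le> \<delta>" "A \<subseteq> (\<Union>i\<in>I. U i)"
    and bd: "\<And>i. i \<in> I \<Longrightarrow> bounded (U i)" "\<And>i. i \<in> I \<Longrightarrow> diameter (U i) \<le> \<delta>"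
  shows "hausdorff_content d \<delta> A \<le> (\<integral>\<^sup>+i. hausdorff_gauge d (U i) \<partial>count_space I)"
proof -
  define J where "J = to_nat_on I ` I"
  define V where "V j = (if j \<in> J then U (from_nat_into I j) else {})" for j
  have bij: "bij_betw (to_nat_on I) I J"
    unfolding J_def using inj_on_to_nat_on[OF \<open>countable I\<close>] by (rule inj_on_imp_bij_betw)
  have inv: "from_nat_into I (to_nat_on I i) = i" if "i \<in> I" for i
    using that \<open>countable I\<close> by simp
  have mem: "from_nat_into I j \<in> I" if "j \<in> J" for j
    using that inv by (auto simp: J_def)
  have "A \<subseteq> (\<Union>j. V j)"
  proof
    fix x assume "x \<in> A"
    then obtain i where i: "i \<in> I" "x \<in> U i"
      using assms(3) by auto
    then have "x \<in> V (to_nat_on I i)"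
      using inv by (auto simp: V_def J_def)
    then show "x \<in> (\<Union>j. V j)" by blast
  qed
  then have "V \<in> hausdorff_covers \<delta> A"
    using bd mem \<open>0 \<le> \<delta>\<close> by (auto simp: hausdorff_covers_def V_def)
  then have "hausdorff_content d \<delta> A \<le> (\<Sum>j. hausdorff_gauge d (V j))"
    unfolding hausdorff_content_def by (rule INF_lower)
  also have "\<dots> = (\<integral>\<^sup>+j. hausdorff_gauge d (V j) \<partial>count_space UNIV)"
    by (rule nn_integral_count_space_nat[symmetric])
  also have "\<dots> = (\<integral>\<^sup>+j. hausdorff_gauge d (V j) \<partial>count_space J)"
    by (rule nn_integral_count_space_eq) (auto simp: V_def hausdorff_gauge_def)
  also have "\<dots> = (\<integral>\<^sup>+i. hausdorff_gauge d (V (to_nat_on I i)) \<partial>count_space I)"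
    by (rule nn_integral_bij_count_space[OF bij, symmetric])
  also have "\<dots> = (\<integral>\<^sup>+i. hausdorff_gauge d (U i) \<partial>count_space I)"
    by (rule nn_integral_cong) (auto simp: V_def J_def inv)
  finally show ?thesis .
qed

lemma hausdorff_gauge_le:
  assumes "diameter U \<le> r" "0 \<le> r" "bounded U"
  shows "hausdorff_gauge d U \<le> ennreal (unit_ball_vol d * (r / 2) ^ d)"
  using assms diameter_ge_0[OF \<open>bounded U\<close>]
  by (auto simp: hausdorff_gauge_def intro!: ennreal_leI mult_left_mono power_mono)

text \<open>Outer regularity puts \<open>T\<close> into an open set of almost the same measure, and
  that set contains all the cubes. Their interiors are disjoint, so their volumes add up to at most
  its measure.\<close>

lemma dyadic_cube_cover:
  fixes T :: "'a::euclidean_space set"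
  assumes "bounded T" "T \<in> sets borel" "0 < \<eta>" "0 < r"
  obtains I :: "'a set set" and u v :: "'a set \<Rightarrow> 'a" and h :: "'a set \<Rightarrow> real"
  where "countable I" "\<And>K. K \<in> I \<Longrightarrow> K = cbox (u K) (v K)" "\<And>K. K \<in> I \<Longrightarrow> 0 < h K"
    "\<And>K b. K \<in> I \<Longrightarrow> b \<in> Basis \<Longrightarrow> v K \<bullet> b - u K \<bullet> b = h K"
    "\<And>K. K \<in> I \<Longrightarrow> \<exists>x. K \<subseteq> ball x r" "T \<subseteq> \<Union>I"
    "(\<integral>\<^sup>+K. ennreal (h K ^ DIM('a)) \<partial>count_space I) \<le> emeasure lborel T + ennreal \<eta>"
proof -
  obtain O' where O': "open O'" "T \<subseteq> O'" "emeasure lborel (O' - T) < \<eta>"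
    using outer_regular_lborel[OF \<open>T \<in> sets borel\<close> \<open>0 < \<eta>\<close>] by blast
  obtain B where B: "0 < B" "\<And>x. x \<in> T \<Longrightarrow> norm x \<le> B"
    using \<open>bounded T\<close> by (auto simp: bounded_pos)
  define a b :: 'a where "a = - B *\<^sub>R One" and "b = B *\<^sub>R One"
  have ab: "a \<bullet> i = - B" "b \<bullet> i = B" if "i \<in> Basis" for i
    using that by (simp_all add: a_def b_def)
  have "T \<subseteq> cbox a b"
  proof
    fix x assume "x \<in> T"
    then have "\<bar>x \<bullet> i\<bar> \<le> B" if "i \<in> Basis" for i
      using B(2) Basis_le_norm[OF that, of x] by (meson order_trans)
    then show "x \<in> cbox a b"
      by (auto simp: mem_box ab abs_le_iff) (smt (verit))+
  qed
  moreover have "box a b \<noteq> {}"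
    using B by (auto simp: box_ne_empty ab)
  \<comment> \<open>Every cube obtained from this gauge is tagged by a point of \<open>T\<close>,
    hence lies in \<open>O'\<close> and in a ball of radius \<open>r\<close>. The second branch only
    makes the gauge total.\<close>
  moreover have "gauge (\<lambda>x. if x \<in> O' then O' \<inter> ball x r else ball x r)"
    using O' \<open>0 < r\<close> by (auto simp: gauge_def)
  ultimately obtain I where I: "countable I" "\<Union>I \<subseteq> cbox a b"
    "\<And>K. K \<in> I \<Longrightarrow> interior K \<noteq> {} \<and> (\<exists>c d. K = cbox c d)"
    "pairwise (\<lambda>A B. interior A \<inter> interior B = {}) I"
    "\<And>K. K \<in> I \<Longrightarrow> \<exists>x \<in> T \<inter> K. K \<subseteq> (if x \<in> O' then O' \<inter> ball x r else ball x r)"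
    "\<And>u v. cbox u v \<in> I \<Longrightarrow> \<exists>n. \<forall>i \<in> Basis. v \<bullet> i - u \<bullet> i = (b \<bullet> i - a \<bullet> i) / 2^n"
    "T \<subseteq> \<Union>I"
    by (rule covering_lemma) blast
  have "\<exists>c d h. K = cbox c d \<and> 0 < h \<and> (\<forall>i\<in>Basis. d \<bullet> i - c \<bullet> i = h)" if K: "K \<in> I" for K
  proof -
    obtain c d where cd: "K = cbox c d" using I(3)[OF K] by blast
    then obtain n where "\<forall>i \<in> Basis. d \<bullet> i - c \<bullet> i = (b \<bullet> i - a \<bullet> i) / 2^n"
      using I(6) K by blast
    then have "0 < 2 * B / 2 ^ n \<and> (\<forall>i\<in>Basis. d \<bullet> i - c \<bullet> i = 2 * B / 2 ^ n)"
      using B by (simp add: ab)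
    with cd show ?thesis by blast
  qed
  then obtain u v h where uv: "\<And>K. K \<in> I \<Longrightarrow> K = cbox (u K) (v K)"
    and h: "\<And>K. K \<in> I \<Longrightarrow> 0 < h K" "\<And>K b. K \<in> I \<Longrightarrow> b \<in> Basis \<Longrightarrow> v K \<bullet> b - u K \<bullet> b = h K"
    by metis
  have KO: "K \<subseteq> O'" and Kball: "\<exists>x. K \<subseteq> ball x r" if "K \<in> I" for K
    using I(5)[OF that] O'(2) by (auto split: if_splits)
  have "emeasure lborel (interior K) = ennreal (h K ^ DIM('a))" if "K \<in> I" for K
  proof -
    have "u K \<bullet> b \<le> v K \<bullet> b" if "b \<in> Basis" for b
      using h(1)[OF \<open>K \<in> I\<close>] h(2)[OF \<open>K \<in> I\<close> that] by linarith
    then have "emeasure lborel (box (u K) (v K)) = ennreal (h K ^ DIM('a))"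
      using h(2)[OF \<open>K \<in> I\<close>] by (simp add: inner_diff_left)
    then show ?thesis
      using uv[OF that] interior_cbox by metis
  qed
  then have "(\<integral>\<^sup>+K. ennreal (h K ^ DIM('a)) \<partial>count_space I)
      = (\<integral>\<^sup>+K. emeasure lborel (interior K) \<partial>count_space I)"
    by (intro nn_integral_cong) simp
  also have "\<dots> = emeasure lborel (\<Union>K\<in>I. interior K)"
    using I(1,4) by (intro emeasure_UN_countable[symmetric])
      (auto simp: disjoint_family_on_def pairwise_def)
  also have "\<dots> \<le> emeasure lborel O'"
    using KO interior_subset O' by (intro emeasure_mono) (blast, simp)
  also have "O' = T \<union> (O' - T)"
    using O' by auto
  also have "emeasure lborel (T \<union> (O' - T)) \<le> emeasure lborel T + emeasure lborel (O' - T)"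
    using assms O' by (intro emeasure_subadditive) auto
  also have "\<dots> \<le> emeasure lborel T + ennreal \<eta>"
    using O'(3) by (intro add_left_mono) simp
  finally show ?thesis
    using that I(1,7) uv h Kball by blast
qed

text \<open>Each slice of a cover of \<open>T\<close> by cubes, at height \<open>t\<close>, yields a cover of \<open>S\<close>; averaging over \<open>t\<close> turns
  the \<open>d\<close>-th power of the side lengths into volumes.\<close>

lemma hausdorff_content_graph_le:
  fixes S T :: "'a::euclidean_space set"
  assumes e: "e \<in> Basis" and L: "0 < L" and "0 < \<delta>"
    and lip: "\<And>X Y. \<lbrakk>X \<in> S; Y \<in> S\<rbrakk> \<Longrightarrow> norm (X - Y) \<le> L * norm (set_coord e 0 (X - Y))"
    and T: "\<And>X t. \<lbrakk>X \<in> S; 0 \<le> t; t \<le> 1\<rbrakk> \<Longrightarrow> set_coord e t X \<in> T"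
      "T \<in> sets borel" "bounded T"
  defines "d \<equiv> DIM('a) - 1"
  defines "c \<equiv> unit_ball_vol (real d) * (L * DIM('a) / 2) ^ d"
  shows "hausdorff_content d \<delta> S \<le> ennreal c * emeasure lborel T"
proof (rule ennreal_le_epsilon)
  fix \<epsilon> :: real assume \<epsilon>: "0 < \<epsilon>"
  have c: "0 \<le> c" using L by (simp add: c_def)
  \<comment> \<open>Two lifts in a ball of radius \<open>r\<close> are at most \<open>2 * r\<close>
    apart, so the original points are at most \<open>L * (2 * r) = \<delta>\<close> apart.\<close>
  define r where "r = \<delta> / (2 * L)"
  have r: "0 < r" using L \<open>0 < \<delta>\<close> by (simp add: r_def)
  have "0 < \<epsilon> / (c + 1)" using c \<epsilon> by simp
  with r obtain I :: "'a set set" and u v :: "'a set \<Rightarrow> 'a" and h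
    where I: "countable I" "\<And>K. K \<in> I \<Longrightarrow> K = cbox (u K) (v K)" "\<And>K. K \<in> I \<Longrightarrow> 0 < h K"
    "\<And>K b. K \<in> I \<Longrightarrow> b \<in> Basis \<Longrightarrow> v K \<bullet> b - u K \<bullet> b = h K"
    "\<And>K. K \<in> I \<Longrightarrow> \<exists>x. K \<subseteq> ball x r" "T \<subseteq> \<Union>I"
    and sum: "(\<integral>\<^sup>+K. ennreal (h K ^ DIM('a)) \<partial>count_space I) \<le> emeasure lborel T + ennreal (\<epsilon> / (c + 1))"
    using dyadic_cube_cover[OF \<open>bounded T\<close> \<open>T \<in> sets borel\<close>] by metis
  have slice: "hausdorff_content d \<delta> S
      \<le> (\<integral>\<^sup>+K. ennreal (c * h K ^ d) * indicator {u K \<bullet> e..v K \<bullet> e} t \<partial>count_space I)"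
    if t: "t \<in> {0..1}" for t :: real
  proof -
    \<comment> \<open>The points of \<open>S\<close> whose lift to height \<open>t\<close> falls
      into \<open>K\<close>. Differences of lifts have no \<open>e\<close> component, so
      \<open>lip\<close> bounds the size of \<open>U K\<close> by that of \<open>K\<close>, whatever
      \<open>t\<close> is.\<close>
    define U where "U K = {X \<in> S. set_coord e t X \<in> K}" for K
    have dist_U: "norm (X - Y) \<le> L * norm (set_coord e t X - set_coord e t Y)"
      if "X \<in> U K" "Y \<in> U K" for K X Y
      using that lip by (auto simp: U_def set_coord_diff)
    have U1: "norm (X - Y) \<le> \<delta>" if K: "K \<in> I" and XY: "X \<in> U K" "Y \<in> U K" for K X Y
    proof -
      obtain x where "K \<subseteq> ball x r" using I(5) K by blast
      then have "dist x (set_coord e t X) < r" "dist x (set_coord e t Y) < r"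
        using XY by (auto simp: U_def)
      then have "norm (set_coord e t X - set_coord e t Y) \<le> 2 * r"
        unfolding dist_norm[symmetric]
        using dist_triangle3[of "set_coord e t X" "set_coord e t Y" x] by linarith
      then have "L * norm (set_coord e t X - set_coord e t Y) \<le> L * (2 * r)"
        using L by (intro mult_left_mono) auto
      with dist_U[OF XY] show ?thesis
        using L by (simp add: r_def)
    qed
    have U2: "norm (X - Y) \<le> L * DIM('a) * h K" if K: "K \<in> I" and XY: "X \<in> U K" "Y \<in> U K" for K X Y
    proof -
      let ?x = "set_coord e t X" and ?y = "set_coord e t Y"
      have "?x \<in> cbox (u K) (v K)" "?y \<in> cbox (u K) (v K)"
        using XY I(2)[OF K] by (auto simp: U_def)
      then have "\<bar>(?x - ?y) \<bullet> b\<bar> \<le> h K" if "b \<in> Basis" for b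
        using I(4)[OF K that] that by (auto simp: mem_box inner_diff_left) (smt (verit))
      then have "(\<Sum>b\<in>Basis. \<bar>(?x - ?y) \<bullet> b\<bar>) \<le> (\<Sum>b\<in>(Basis :: 'a set). h K)"
        by (rule sum_mono)
      then have "norm (?x - ?y) \<le> DIM('a) * h K"
        using norm_le_l1[of "?x - ?y"] by simp
      then have "L * norm (?x - ?y) \<le> L * (DIM('a) * h K)"
        using L by (intro mult_left_mono) auto
      with dist_U[OF XY] show ?thesis by (simp add: mult.assoc)
    qed
    have bdd: "bounded (U K)" if "K \<in> I" for K
      using U1[OF that] by (auto simp: bounded_two_points dist_norm)
    have "hausdorff_content d \<delta> S \<le> (\<integral>\<^sup>+K. hausdorff_gauge d (U K) \<partial>count_space I)"
    proof (rule hausdorff_content_le_countable)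
      show "S \<subseteq> (\<Union>K\<in>I. U K)"
        using T(1) t I(6) by (fastforce simp: U_def)
      show "diameter (U K) \<le> \<delta>" if "K \<in> I" for K
        using U1[OF that] \<open>0 < \<delta>\<close> by (intro diameter_le) auto
    qed (use I \<open>0 < \<delta>\<close> bdd in auto)
    also have "\<dots> \<le> (\<integral>\<^sup>+K. ennreal (c * h K ^ d) * indicator {u K \<bullet> e..v K \<bullet> e} t \<partial>count_space I)"
    proof (rule nn_integral_mono)
      fix K assume "K \<in> space (count_space I)"
      then have K: "K \<in> I" by simp
      show "hausdorff_gauge d (U K) \<le> ennreal (c * h K ^ d) * indicator {u K \<bullet> e..v K \<bullet> e} t"
      proof (cases "U K = {}")
        case True
        then show ?thesis by (simp add: hausdorff_gauge_def)
      next
        case False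
        then obtain X where "set_coord e t X \<in> cbox (u K) (v K)"
          using I(2)[OF K] by (auto simp: U_def)
        then have "t \<in> {u K \<bullet> e..v K \<bullet> e}"
          using e by (auto simp: mem_box dest!: bspec[of _ _ e])
        moreover have "hausdorff_gauge d (U K) \<le> ennreal (unit_ball_vol d * (L * DIM('a) * h K / 2) ^ d)"
          using U2[OF K] I(3)[OF K] L bdd[OF K] by (intro hausdorff_gauge_le diameter_le) auto
        moreover have "unit_ball_vol d * (L * DIM('a) * h K / 2) ^ d = c * h K ^ d"
          by (simp add: c_def power_mult_distrib power_divide)
        ultimately show ?thesis by simp
      qed
    qed
    finally show ?thesis .
  qed
  \<comment> \<open>The left side does not depend on \<open>t\<close>. After Tonelli, each cube is
    seen for a set of heights of length \<open>h K\<close>, which is the factor missing between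
    \<open>h K ^ d\<close> and the volume of the cube.\<close>
  have "hausdorff_content d \<delta> S = (\<integral>\<^sup>+t. hausdorff_content d \<delta> S * indicator {0..1::real} t \<partial>lborel)"
    by (simp add: nn_integral_cmult_indicator)
  also have "\<dots> \<le> (\<integral>\<^sup>+t. \<integral>\<^sup>+K. ennreal (c * h K ^ d) * indicator {u K \<bullet> e..v K \<bullet> e} t \<partial>count_space I \<partial>lborel)"
    using slice by (intro nn_integral_mono) (auto split: split_indicator)
  also have "\<dots> = (\<integral>\<^sup>+K. \<integral>\<^sup>+t. ennreal (c * h K ^ d) * indicator {u K \<bullet> e..v K \<bullet> e} t \<partial>lborel \<partial>count_space I)"
    by (rule nn_integral_count_space_nn_integral) (use I in auto)
  also have "\<dots> = (\<integral>\<^sup>+K. ennreal c * ennreal (h K ^ DIM('a)) \<partial>count_space I)"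
  proof (rule nn_integral_cong)
    fix K assume "K \<in> space (count_space I)"
    then have K: "K \<in> I" by simp
    have "DIM('a) = Suc d" using DIM_positive[where 'a='a] by (simp add: d_def)
    moreover have "u K \<bullet> e \<le> v K \<bullet> e" "v K \<bullet> e - u K \<bullet> e = h K"
      using I(3)[OF K] I(4)[OF K e] by auto
    ultimately show "(\<integral>\<^sup>+t. ennreal (c * h K ^ d) * indicator {u K \<bullet> e..v K \<bullet> e} t \<partial>lborel)
        = ennreal c * ennreal (h K ^ DIM('a))"
      using c I(3)[OF K]
      by (simp add: nn_integral_cmult_indicator ennreal_mult[symmetric] algebra_simps)
  qed
  also have "\<dots> = ennreal c * (\<integral>\<^sup>+K. ennreal (h K ^ DIM('a)) \<partial>count_space I)"
    by (rule nn_integral_cmult) simp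
  also have "\<dots> \<le> ennreal c * (emeasure lborel T + ennreal (\<epsilon> / (c + 1)))"
    by (intro mult_left_mono sum) simp
  also have "\<dots> = ennreal c * emeasure lborel T + ennreal (c * (\<epsilon> / (c + 1)))"
    using c \<epsilon> by (simp add: distrib_left ennreal_mult[symmetric])
  also have "\<dots> \<le> ennreal c * emeasure lborel T + ennreal \<epsilon>"
    using c \<epsilon> by (intro add_left_mono ennreal_leI) (simp add: field_simps)
  finally show "hausdorff_content d \<delta> S \<le> ennreal c * emeasure lborel T + ennreal \<epsilon>" .
qed

section \<open>From contents of graphs to measures of and integrals over graphs\<close>

definition graph_const :: "'a::euclidean_space itself \<Rightarrow> real \<Rightarrow> real" where
  "graph_const _ L = unit_ball_vol (real (DIM('a) - 1)) * (L * DIM('a) / 2) ^ (DIM('a) - 1)"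

lemma hausdorff_outer_graph_le:
  fixes S T :: "'a::euclidean_space set"
  assumes "e \<in> Basis" "0 < L"
    and "\<And>X Y. \<lbrakk>X \<in> S; Y \<in> S\<rbrakk> \<Longrightarrow> norm (X - Y) \<le> L * norm (set_coord e 0 (X - Y))"
    and "\<And>X t. \<lbrakk>X \<in> S; 0 \<le> t; t \<le> 1\<rbrakk> \<Longrightarrow> set_coord e t X \<in> T" "T \<in> sets borel" "bounded T"
  shows "hausdorff_outer (DIM('a) - 1) S \<le> ennreal (graph_const TYPE('a) L) * emeasure lborel T"
  unfolding hausdorff_outer_def graph_const_def
  using assms by (intro SUP_least hausdorff_content_graph_le) auto

text \<open>\<open>\<Psi>\<close> collapses each line parallel to \<open>e\<close> through a point
  of \<open>S\<close> to that point, so the set on the right contains the unit cylinder over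
  \<open>A\<close>. The outer bound requires a bounded cylinder, whence the exhaustion of
  \<open>A\<close> by balls and continuity from below.\<close>

lemma hausdorff_measure_graph_le:
  fixes S A :: "'a::euclidean_space set"
  assumes "e \<in> Basis" "0 < L"
    and lip: "\<And>X Y. \<lbrakk>X \<in> S; Y \<in> S\<rbrakk> \<Longrightarrow> norm (X - Y) \<le> L * norm (set_coord e 0 (X - Y))"
    and [measurable]: "\<Psi> \<in> borel_measurable borel"
    and \<Psi>: "\<And>X t. X \<in> S \<Longrightarrow> \<Psi> (set_coord e t X) = X"
    and "A \<subseteq> S" and [measurable]: "A \<in> sets borel"
  shows "emeasure (hausdorff_measure (DIM('a) - 1)) A
    \<le> ennreal (graph_const TYPE('a) L) * emeasure lborel {X. X \<bullet> e \<in> {0..1} \<and> \<Psi> X \<in> A}"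
proof -
  define T where "T = {X. X \<bullet> e \<in> {0..1} \<and> \<Psi> X \<in> A}"
  have [measurable]: "T \<in> sets borel" unfolding T_def by measurable
  define A' where "A' k = A \<inter> cball 0 (real k)" for k :: nat
  have [measurable]: "A' k \<in> sets borel" for k unfolding A'_def by measurable
  have "emeasure (hausdorff_measure (DIM('a) - 1)) (A' k)
      \<le> ennreal (graph_const TYPE('a) L) * emeasure lborel (T \<inter> cball 0 (2 * real k + 1))" for k
    unfolding emeasure_hausdorff_measure[OF \<open>A' k \<in> sets borel\<close>]
  proof (rule hausdorff_outer_graph_le)
    fix X t assume X: "X \<in> A' k" and t: "0 \<le> t" "t \<le> (1::real)"
    \<comment> \<open>Lifting a point of norm at most \<open>k\<close> moves it by at most
      \<open>1 + k\<close>, which explains the radius \<open>2 * real k + 1\<close>.\<close>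
    have "norm (set_coord e t X) \<le> norm X + \<bar>t - X \<bullet> e\<bar>"
      using norm_triangle_ineq[of X "(t - X \<bullet> e) *\<^sub>R e"] \<open>e \<in> Basis\<close> by (simp add: set_coord_def)
    also have "\<dots> \<le> 2 * real k + 1"
      using X t Basis_le_norm[OF \<open>e \<in> Basis\<close>, of X] by (auto simp: A'_def)
    finally show "set_coord e t X \<in> T \<inter> cball 0 (2 * real k + 1)"
      using X t \<Psi> \<open>A \<subseteq> S\<close> \<open>e \<in> Basis\<close> by (auto simp: T_def A'_def)
  next
    show "norm (X - Y) \<le> L * norm (set_coord e 0 (X - Y))" if "X \<in> A' k" "Y \<in> A' k" for X Y
      using that \<open>A \<subseteq> S\<close> by (intro lip) (auto simp: A'_def)
  qed (use assms in auto)
  also have "\<dots> k \<le> ennreal (graph_const TYPE('a) L) * emeasure lborel T" for k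
    by (intro mult_left_mono emeasure_mono) auto
  finally have "(SUP k. emeasure (hausdorff_measure (DIM('a) - 1)) (A' k))
      \<le> ennreal (graph_const TYPE('a) L) * emeasure lborel T"
    by (intro SUP_least)
  moreover have "(SUP k. emeasure (hausdorff_measure (DIM('a) - 1)) (A' k))
      = emeasure (hausdorff_measure (DIM('a) - 1)) (\<Union>k. A' k)"
    by (rule SUP_emeasure_incseq) (auto simp: A'_def incseq_def)
  moreover have "(\<Union>k. A' k) = A"
    using real_arch_simple by (auto simp: A'_def)
  ultimately show ?thesis by (simp add: T_def)
qed

text \<open>The bound on sets is an inequality between measures: \<open>M\<close>, Hausdorff measure
  restricted to \<open>S\<close>, is at most a multiple of \<open>N\<close>, the image under
  \<open>\<Psi>\<close> of Lebesgue measure on the part of the slab that \<open>\<Psi>\<close> sends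
  into \<open>S\<close>. Integrating \<open>g\<close> against both gives the claim.\<close>

lemma nn_integral_hausdorff_graph_le:
  fixes S :: "'a::euclidean_space set"
  assumes "e \<in> Basis" "0 < L"
    and lip: "\<And>X Y. \<lbrakk>X \<in> S; Y \<in> S\<rbrakk> \<Longrightarrow> norm (X - Y) \<le> L * norm (set_coord e 0 (X - Y))"
    and \<Psi>[measurable]: "\<Psi> \<in> borel_measurable borel"
    and \<Psi>_eq: "\<And>X t. X \<in> S \<Longrightarrow> \<Psi> (set_coord e t X) = X"
    and [measurable]: "S \<in> sets borel" "g \<in> borel_measurable borel"
  shows "(\<integral>\<^sup>+X\<in>S. g X \<partial>hausdorff_measure (DIM('a) - 1))
    \<le> ennreal (graph_const TYPE('a) L) *
      (\<integral>\<^sup>+X. indicator {0..1} (X \<bullet> e) * (g (\<Psi> X) * indicator S (\<Psi> X)) \<partial>lborel)"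
proof -
  let ?H = "hausdorff_measure (DIM('a) - 1) :: 'a measure"
  define M where "M = density ?H (indicator S)"
  define N where "N = distr (density lborel (\<lambda>X. indicator {0..1} (X \<bullet> e) * indicator S (\<Psi> X))) borel \<Psi>"
  have sets: "sets M = sets (scale_measure (ennreal (graph_const TYPE('a) L)) N)"
    by (simp add: M_def N_def)
  have "emeasure M A \<le> emeasure (scale_measure (ennreal (graph_const TYPE('a) L)) N) A"
    if "A \<in> sets M" for A
  proof -
    have [measurable]: "A \<in> sets borel" using that by (simp add: M_def)
    have "emeasure M A = (\<integral>\<^sup>+X. indicator S X * indicator A X \<partial>?H)"
      by (simp add: M_def emeasure_density)
    also have "\<dots> = (\<integral>\<^sup>+X. indicator (A \<inter> S) X \<partial>?H)"
      by (intro nn_integral_cong) (auto split: split_indicator)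
    also have "\<dots> = emeasure ?H (A \<inter> S)"
      by (rule nn_integral_indicator) simp
    also have "\<dots> \<le> ennreal (graph_const TYPE('a) L) * emeasure lborel {X. X \<bullet> e \<in> {0..1} \<and> \<Psi> X \<in> A \<inter> S}"
      by (rule hausdorff_measure_graph_le[where S = S]) (use assms in auto)
    also have "emeasure lborel {X. X \<bullet> e \<in> {0..1} \<and> \<Psi> X \<in> A \<inter> S}
        = (\<integral>\<^sup>+X. indicator {X. X \<bullet> e \<in> {0..1} \<and> \<Psi> X \<in> A \<inter> S} X \<partial>lborel)"
      by (rule nn_integral_indicator[symmetric]) measurable
    also have "\<dots> = (\<integral>\<^sup>+X. indicator {0..1} (X \<bullet> e) * indicator S (\<Psi> X) * indicator A (\<Psi> X) \<partial>lborel)"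
      by (intro nn_integral_cong) (auto split: split_indicator)
    also have "\<dots> = (\<integral>\<^sup>+X. indicator A X \<partial>N)"
      by (simp add: N_def nn_integral_distr nn_integral_density del: nn_integral_indicator)
    also have "\<dots> = emeasure N A"
      by (rule nn_integral_indicator) (simp add: N_def)
    finally show ?thesis by simp
  qed
  then have "M \<le> scale_measure (ennreal (graph_const TYPE('a) L)) N"
    using sets by (subst le_measure) auto
  then have "nn_integral M g \<le> nn_integral (scale_measure (ennreal (graph_const TYPE('a) L)) N) g"
    by (rule nn_integral_mono_measure[OF sets])
  also have "\<dots> = ennreal (graph_const TYPE('a) L) * nn_integral N g"
    by (rule nn_integral_scale_measure) (simp add: N_def)
  also have "nn_integral N g
      = (\<integral>\<^sup>+X. indicator {0..1} (X \<bullet> e) * (g (\<Psi> X) * indicator S (\<Psi> X)) \<partial>lborel)"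
    by (simp add: N_def nn_integral_distr nn_integral_density ac_simps)
  finally show ?thesis
    by (simp add: M_def nn_integral_density mult.commute)
qed

text \<open>The gradient of a quadratic \<open>F\<close> is affine, whence \<open>quad\<close>; \<open>diag\<close> says that \<open>F\<close> is affine in each
  single coordinate, so that \<open>{F = 0}\<close> is a graph over each coordinate hyperplane. The cut-off to
  \<open>X \<bullet> e \<in> {0..1}\<close> makes the integral on the right one over the hyperplane.\<close>

lemma delta_integral_le_sum_graphs:
  fixes F :: "'a::euclidean_space \<Rightarrow> real"
  assumes deriv: "\<And>X. GDERIV F X :> G X"
    and quad: "\<And>X Y. 2 * (F Y - F X) = (G X + G Y) \<bullet> (Y - X)"
    and diag: "\<And>X e t. e \<in> Basis \<Longrightarrow> G (X + t *\<^sub>R e) \<bullet> e = G X \<bullet> e"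
    and nz: "\<And>X. F X = 0 \<Longrightarrow> G X \<noteq> 0"
    and [measurable]: "F \<in> borel_measurable borel" "G \<in> borel_measurable borel"
      "g \<in> borel_measurable borel"
  defines "\<Psi> \<equiv> \<lambda>e X. X - (F X / (G X \<bullet> e)) *\<^sub>R e"
  shows "delta_integral F g \<le> ennreal (2 * graph_const TYPE('a) (1 + DIM('a))) *
    (\<Sum>e\<in>Basis. \<integral>\<^sup>+X. indicator {0..1} (X \<bullet> e) *
       (if G X \<bullet> e = 0 then 0 else g (\<Psi> e X) / ennreal (norm (G (\<Psi> e X)))) \<partial>lborel)"
proof -
  let ?H = "hausdorff_measure (DIM('a) - 1) :: 'a measure"
  let ?C = "graph_const TYPE('a) (1 + DIM('a))"
  define k where "k X = g X / ennreal (norm (G X))" for X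
  have [measurable]: "k \<in> borel_measurable borel" unfolding k_def by measurable
  have [measurable]: "\<Psi> e \<in> borel_measurable borel" for e unfolding \<Psi>_def by measurable
  \<comment> \<open>The sign \<open>\<sigma>\<close> of the dominant partial derivative is fixed on
    each piece, so that the derivatives at two points of the piece cannot cancel in
    \<open>G X + G Y\<close>.\<close>
  define S where "S e \<sigma> = {X. F X = 0 \<and> 0 < \<sigma> * (G X \<bullet> e) \<and> (\<forall>b\<in>Basis. \<bar>G X \<bullet> b\<bar> \<le> \<sigma> * (G X \<bullet> e))}"
    for e :: 'a and \<sigma> :: real
  have [measurable]: "S e \<sigma> \<in> sets borel" for e \<sigma>
    unfolding S_def by measurable
  have affine: "F (X + t *\<^sub>R e) = F X + t * (G X \<bullet> e)" if "e \<in> Basis" for X t e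
    using quad[of "X + t *\<^sub>R e" X] diag[OF that, of X t] by (simp add: inner_simps)
  have lip: "norm (X - Y) \<le> (1 + DIM('a)) * norm (set_coord e 0 (X - Y))"
    if \<sigma>: "\<bar>\<sigma>\<bar> = 1" and e: "e \<in> Basis" and X: "X \<in> S e \<sigma>" and Y: "Y \<in> S e \<sigma>" for X Y e \<sigma>
  proof -
    define D where "D = X - Y"
    define M where "M = \<sigma> * (G X \<bullet> e) + \<sigma> * (G Y \<bullet> e)"
    have M: "0 < M" "\<And>b. b \<in> Basis \<Longrightarrow> \<bar>(G X + G Y) \<bullet> b\<bar> \<le> M"
      using X Y by (auto simp: S_def M_def inner_add_left intro: order_trans[OF abs_triangle_ineq add_mono])
    have Me: "M \<le> \<bar>(G X + G Y) \<bullet> e\<bar>"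
    proof -
      have "M = \<sigma> * ((G X + G Y) \<bullet> e)"
        by (simp add: M_def inner_add_left distrib_left)
      also have "\<dots> \<le> \<bar>\<sigma> * ((G X + G Y) \<bullet> e)\<bar>"
        by (rule abs_ge_self)
      finally show ?thesis
        using \<sigma> by (simp add: abs_mult)
    qed
    \<comment> \<open>Both points lie on \<open>F = 0\<close>, so \<open>quad\<close> makes the
      secant \<open>D\<close> orthogonal to \<open>G X + G Y\<close>. Solving for the
      \<open>e\<close> component of \<open>D\<close>, whose coefficient dominates the others, bounds
      it by the remaining components.\<close>
    have "0 = (G Y + G X) \<bullet> D"
      using quad[of X Y] X Y by (simp add: S_def D_def)
    also have "\<dots> = (\<Sum>b\<in>Basis. ((G X + G Y) \<bullet> b) * (D \<bullet> b))"
      by (subst euclidean_inner) (simp add: add.commute)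
    also have "\<dots> = ((G X + G Y) \<bullet> e) * (D \<bullet> e) + (\<Sum>b\<in>Basis - {e}. ((G X + G Y) \<bullet> b) * (D \<bullet> b))"
      using e by (simp add: sum.remove)
    finally have "\<bar>((G X + G Y) \<bullet> e) * (D \<bullet> e)\<bar> = \<bar>\<Sum>b\<in>Basis - {e}. ((G X + G Y) \<bullet> b) * (D \<bullet> b)\<bar>"
      by linarith
    also have "\<dots> \<le> (\<Sum>b\<in>Basis - {e}. M * norm (set_coord e 0 D))"
    proof (rule order_trans[OF sum_abs sum_mono])
      fix b assume b: "b \<in> Basis - {e}"
      have "\<bar>D \<bullet> b\<bar> = \<bar>set_coord e 0 D \<bullet> b\<bar>"
        using b e by (simp add: set_coord_inner_other)
      also have "\<dots> \<le> norm (set_coord e 0 D)"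
        using b by (intro Basis_le_norm) auto
      finally show "\<bar>((G X + G Y) \<bullet> b) * (D \<bullet> b)\<bar> \<le> M * norm (set_coord e 0 D)"
        unfolding abs_mult using M b by (intro mult_mono) auto
    qed
    also have "\<dots> \<le> (\<Sum>b\<in>(Basis :: 'a set). M * norm (set_coord e 0 D))"
      using M by (intro sum_mono2) auto
    finally have "\<bar>(G X + G Y) \<bullet> e\<bar> * \<bar>D \<bullet> e\<bar> \<le> M * (DIM('a) * norm (set_coord e 0 D))"
      by (simp add: abs_mult ac_simps)
    moreover have "M * \<bar>D \<bullet> e\<bar> \<le> \<bar>(G X + G Y) \<bullet> e\<bar> * \<bar>D \<bullet> e\<bar>"
      using Me by (intro mult_right_mono) auto
    ultimately have "\<bar>D \<bullet> e\<bar> \<le> DIM('a) * norm (set_coord e 0 D)"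
      using M(1) by (meson mult_le_cancel_left_pos order_trans)
    moreover have "D = set_coord e 0 D + (D \<bullet> e) *\<^sub>R e"
      by (simp add: set_coord_def)
    then have "norm D \<le> norm (set_coord e 0 D) + \<bar>D \<bullet> e\<bar>"
      using norm_triangle_ineq[of "set_coord e 0 D" "(D \<bullet> e) *\<^sub>R e"] e by simp
    ultimately show ?thesis
      by (simp add: D_def algebra_simps)
  qed
  \<comment> \<open>\<open>F\<close> is affine along \<open>e\<close> with nonzero slope at
    \<open>X\<close>, so a single Newton step from anywhere on the line returns to the zero
    \<open>X\<close>.\<close>
  have \<Psi>_eq: "\<Psi> e (set_coord e t X) = X" if "e \<in> Basis" "X \<in> S e \<sigma>" for e \<sigma> t X
    using that by (auto simp: S_def \<Psi>_def set_coord_def affine diag)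
  have piece: "(\<integral>\<^sup>+X\<in>S e \<sigma>. k X \<partial>?H) \<le> ennreal ?C *
      (\<integral>\<^sup>+X. indicator {0..1} (X \<bullet> e) * (if G X \<bullet> e = 0 then 0 else k (\<Psi> e X)) \<partial>lborel)"
    if \<sigma>: "\<bar>\<sigma>\<bar> = 1" and e: "e \<in> Basis" for e \<sigma>
  proof -
    have "(\<integral>\<^sup>+X\<in>S e \<sigma>. k X \<partial>?H) \<le> ennreal ?C *
      (\<integral>\<^sup>+X. indicator {0..1} (X \<bullet> e) * (k (\<Psi> e X) * indicator (S e \<sigma>) (\<Psi> e X)) \<partial>lborel)"
      by (rule nn_integral_hausdorff_graph_le) (use e lip[OF \<sigma>] \<Psi>_eq in auto)
    also have "\<dots> \<le> ennreal ?C *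
      (\<integral>\<^sup>+X. indicator {0..1} (X \<bullet> e) * (if G X \<bullet> e = 0 then 0 else k (\<Psi> e X)) \<partial>lborel)"
    proof (intro mult_left_mono nn_integral_mono)
      fix X
      \<comment> \<open>Division by zero yields 0, so here \<open>\<Psi> e X = X\<close>, and
        \<open>X\<close> is outside \<open>S e \<sigma>\<close> because its slope along
        \<open>e\<close> is not strictly of sign \<open>\<sigma>\<close>.\<close>
      have "\<Psi> e X \<notin> S e \<sigma>" if "G X \<bullet> e = 0"
        using that by (auto simp: S_def \<Psi>_def)
      then show "k (\<Psi> e X) * indicator (S e \<sigma>) (\<Psi> e X) \<le> (if G X \<bullet> e = 0 then 0 else k (\<Psi> e X))"
        by (auto split: split_indicator)
    qed auto
    finally show ?thesis .
  qed
  \<comment> \<open>Choose \<open>e\<close> with the largest partial derivative in absolute value;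
    it is nonzero because the gradient is.\<close>
  have cover: "\<exists>e\<in>Basis. X \<in> S e 1 \<or> X \<in> S e (-1)" if "F X = 0" for X
  proof -
    have "Max ((\<lambda>b. \<bar>G X \<bullet> b\<bar>) ` Basis) \<in> (\<lambda>b. \<bar>G X \<bullet> b\<bar>) ` Basis"
      by (rule Max_in) auto
    then obtain e where e: "e \<in> Basis" "Max ((\<lambda>b. \<bar>G X \<bullet> b\<bar>) ` Basis) = \<bar>G X \<bullet> e\<bar>"
      by (rule imageE)
    then have max: "\<bar>G X \<bullet> b\<bar> \<le> \<bar>G X \<bullet> e\<bar>" if "b \<in> Basis" for b
      using that by (metis Max_ge finite_Basis finite_imageI imageI)
    have "G X \<bullet> e \<noteq> 0"
    proof
      assume "G X \<bullet> e = 0"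
      then have "G X \<bullet> b = 0 \<bullet> b" if "b \<in> Basis" for b
        using max[OF that] by simp
      then have "G X = 0" by (rule euclidean_eqI)
      then show False using nz that by simp
    qed
    then have "X \<in> S e 1 \<or> X \<in> S e (-1)"
      using max that by (cases "0 < G X \<bullet> e") (simp_all add: S_def)
    with e(1) show ?thesis ..
  qed
  have "delta_integral F g = (\<integral>\<^sup>+X. k X * indicator {X. F X = 0} X \<partial>?H)"
    by (simp add: delta_integral_def k_def gradient_eq[OF deriv])
  also have "\<dots> \<le> (\<integral>\<^sup>+X. (\<Sum>e\<in>Basis. k X * indicator (S e 1) X + k X * indicator (S e (-1)) X) \<partial>?H)"
  proof (rule nn_integral_mono)
    fix X
    show "k X * indicator {X. F X = 0} X
      \<le> (\<Sum>e\<in>Basis. k X * indicator (S e 1) X + k X * indicator (S e (-1)) X)"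
    proof (cases "F X = 0")
      case True
      then obtain e where e: "e \<in> Basis" "X \<in> S e 1 \<or> X \<in> S e (-1)"
        using cover by blast
      then have "k X * indicator {X. F X = 0} X \<le> k X * indicator (S e 1) X + k X * indicator (S e (-1)) X"
        using True by (auto split: split_indicator)
      also have "\<dots> \<le> (\<Sum>e\<in>Basis. k X * indicator (S e 1) X + k X * indicator (S e (-1)) X)"
        using e by (intro member_le_sum) auto
      finally show ?thesis .
    qed simp
  qed
  also have "\<dots> = (\<Sum>e\<in>Basis. (\<integral>\<^sup>+X\<in>S e 1. k X \<partial>?H) + (\<integral>\<^sup>+X\<in>S e (-1). k X \<partial>?H))"
    by (simp add: nn_integral_sum nn_integral_add)
  also have "\<dots> \<le> (\<Sum>e\<in>Basis. ennreal (2 * ?C) *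
      (\<integral>\<^sup>+X. indicator {0..1} (X \<bullet> e) * (if G X \<bullet> e = 0 then 0 else k (\<Psi> e X)) \<partial>lborel))"
  proof (rule sum_mono)
    fix e :: 'a assume e: "e \<in> Basis"
    show "(\<integral>\<^sup>+X\<in>S e 1. k X \<partial>?H) + (\<integral>\<^sup>+X\<in>S e (-1). k X \<partial>?H) \<le> ennreal (2 * ?C) *
      (\<integral>\<^sup>+X. indicator {0..1} (X \<bullet> e) * (if G X \<bullet> e = 0 then 0 else k (\<Psi> e X)) \<partial>lborel)"
      using add_mono[OF piece[of 1 e] piece[of "-1" e]] e
      by (simp add: ennreal_mult' mult.assoc flip: mult_2)
  qed
  finally show ?thesis
    unfolding k_def by (simp add: sum_distrib_left)
qed

section \<open>Invariance under isometries\<close>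

text \<open>The image under \<open>h\<close> of a cover of the preimage covers \<open>A\<close>, by
  surjectivity, and has no larger diameters.\<close>

lemma hausdorff_outer_isometry_le:
  fixes h :: "'b::real_normed_vector \<Rightarrow> 'a::real_normed_vector"
  assumes iso: "\<And>x y. dist (h x) (h y) = dist x y" and "surj h"
  shows "hausdorff_outer d A \<le> hausdorff_outer d (h -` A)"
  unfolding hausdorff_outer_def hausdorff_content_def
proof (intro SUP_mono' INF_mono bexI)
  fix \<delta> and U assume U: "U \<in> hausdorff_covers \<delta> (h -` A)"
  have dist_le: "dist u v \<le> diameter (U i)" if "u \<in> h ` U i" "v \<in> h ` U i" for u v i
    using that U iso diameter_bounded_bound[of "U i"] by (auto simp: hausdorff_covers_def)
  have bd: "bounded (h ` U i)" and dm: "diameter (h ` U i) \<le> diameter (U i)" for i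
    using dist_le[of _ i] U diameter_ge_0[of "U i"]
    by (auto simp: bounded_two_points hausdorff_covers_def intro!: diameter_le dist_le simp flip: dist_norm)
  show "(\<lambda>i. h ` U i) \<in> hausdorff_covers \<delta> A"
    unfolding hausdorff_covers_def
  proof (intro CollectI conjI allI)
    show "A \<subseteq> (\<Union>i. h ` U i)"
    proof
      fix y assume "y \<in> A"
      moreover obtain x where "y = h x" using \<open>surj h\<close> by (metis surjD)
      moreover from calculation obtain i where "x \<in> U i"
        using U by (auto simp: hausdorff_covers_def)
      ultimately show "y \<in> (\<Union>i. h ` U i)"
        by blast
    qed
    show "diameter (h ` U i) \<le> \<delta>" for i
      using dm[of i] U by (auto simp: hausdorff_covers_def intro: order_trans)
  qed (rule bd)
  show "(\<Sum>i. hausdorff_gauge d (h ` U i)) \<le> (\<Sum>i. hausdorff_gauge d (U i))"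
    using dm bd by (intro suminf_le summableI)
      (auto simp: hausdorff_gauge_def diameter_ge_0 intro!: ennreal_leI mult_left_mono power_mono)
qed

text \<open>Serves to carry the integral for \<open>Delta\<close>, posed on a product of two spaces,
  over to a space of block vectors. An isometry preserves the norm of the gradient, and the image of
  Hausdorff measure under \<open>h\<close> dominates Hausdorff measure.\<close>

lemma delta_integral_isometry_le:
  fixes h :: "'b::euclidean_space \<Rightarrow> 'a::euclidean_space"
  assumes lin: "linear h" and iso: "\<And>x. norm (h x) = norm x" and inv: "\<And>y. h (k y) = y"
    and dim: "DIM('b) = DIM('a)"
    and deriv: "\<And>X. GDERIV F X :> G X"
    and [measurable]: "F \<in> borel_measurable borel" "G \<in> borel_measurable borel" "g \<in> borel_measurable borel"
  shows "delta_integral F g \<le> delta_integral (F \<circ> h) (g \<circ> h)"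
proof -
  let ?Ha = "hausdorff_measure (DIM('a) - 1) :: 'a measure"
  let ?Hb = "hausdorff_measure (DIM('a) - 1) :: 'b measure"
  have bl: "bounded_linear h" using lin by (simp add: linear_conv_bounded_linear)
  have [measurable]: "h \<in> borel_measurable borel"
    by (rule borel_measurable_continuous_onI[OF linear_continuous_on[OF bl]])
  \<comment> \<open>By polarization \<open>h\<close> preserves inner products, so its right inverse
    \<open>k\<close> is its adjoint and maps the gradient of \<open>F\<close> to that of
    \<open>F \<circ> h\<close>.\<close>
  have inner: "h x \<bullet> y = x \<bullet> k y" for x y
  proof -
    have "h x \<bullet> h z = x \<bullet> z" for z
      using iso[of "x + z"] iso[of x] iso[of z]
      by (simp add: norm_eq_sqrt_inner linear_add[OF lin] inner_simps inner_commute)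
    from this[of "k y"] show ?thesis by (simp add: inv)
  qed
  have "GDERIV (F \<circ> h) X :> k (G (h X))" for X
    using diff_chain_at[OF bounded_linear_imp_has_derivative[OF bl] deriv[unfolded gderiv_def, of "h X"]]
    by (simp add: gderiv_def o_def inner)
  moreover have "norm (k y) = norm y" for y
    using iso[of "k y"] by (simp add: inv)
  ultimately have grad: "norm (gradient (F \<circ> h) X) = norm (G (h X))" for X
    by (metis gradient_eq)
  have sets: "sets ?Ha = sets (distr ?Hb borel h)" by simp
  have "emeasure ?Ha A \<le> emeasure (distr ?Hb borel h) A" if "A \<in> sets ?Ha" for A
  proof -
    have [measurable]: "A \<in> sets borel" using that by simp
    have "hausdorff_outer (DIM('a) - 1) A \<le> hausdorff_outer (DIM('a) - 1) (h -` A)"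
    proof (rule hausdorff_outer_isometry_le)
      show "dist (h x) (h y) = dist x y" for x y
        using iso[of "x - y"] by (simp add: dist_norm linear_diff[OF lin])
      show "surj h" using inv by (rule surjI)
    qed
    moreover have "h -` A \<in> sets borel" by (rule measurable_sets_borel) measurable
    ultimately show ?thesis
      by (simp add: emeasure_distr emeasure_hausdorff_measure)
  qed
  then have "?Ha \<le> distr ?Hb borel h"
    using sets by (subst le_measure) auto
  then have "delta_integral F g
      \<le> (\<integral>\<^sup>+X. g X / ennreal (norm (G X)) * indicator {X. F X = 0} X \<partial>distr ?Hb borel h)"
    unfolding delta_integral_def gradient_eq[OF deriv] by (rule nn_integral_mono_measure[OF sets])
  also have "\<dots> = delta_integral (F \<circ> h) (g \<circ> h)"
    by (simp add: nn_integral_distr delta_integral_def grad dim indicator_def)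
  finally show ?thesis .
qed

section \<open>Negative powers and their one-variable integrals\<close>

text \<open>Unlike \<open>s powr - \<gamma>\<close>, this takes the value \<open>\<infinity>\<close> at \<open>s = 0\<close>.\<close>

definition neg_powr :: "real \<Rightarrow> real \<Rightarrow> ennreal" where
  "neg_powr \<gamma> s = (if s = 0 then top else ennreal (\<bar>s\<bar> powr - \<gamma>))"

lemma neg_powr_measurable [measurable]: "neg_powr \<gamma> \<in> borel_measurable borel"
  unfolding neg_powr_def by measurable

lemma neg_powr_nonzero [simp]: "neg_powr \<gamma> s \<noteq> 0"
  by (auto simp: neg_powr_def)

lemma neg_powr_minus [simp]: "neg_powr \<gamma> (- s) = neg_powr \<gamma> s"
  by (simp add: neg_powr_def)

lemma neg_powr_1 [simp]: "neg_powr \<gamma> 1 = 1"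
  by (simp add: neg_powr_def)

lemma neg_powr_eq: "0 < s \<Longrightarrow> neg_powr \<gamma> s = ennreal (s powr - \<gamma>)"
  by (simp add: neg_powr_def)

lemma neg_powr_add: "neg_powr (a + b) s = neg_powr a s * neg_powr b s"
  by (simp add: neg_powr_def ennreal_mult[symmetric] powr_add[symmetric] ennreal_top_mult)

lemma neg_powr_mult: "neg_powr \<gamma> (s * t) = neg_powr \<gamma> s * neg_powr \<gamma> t"
  by (auto simp: neg_powr_def ennreal_mult[symmetric] powr_mult abs_mult ennreal_top_mult
      ennreal_mult_top)

lemma neg_powr_antimono: "\<lbrakk>0 \<le> \<gamma>; \<bar>s\<bar> \<le> \<bar>t\<bar>\<rbrakk> \<Longrightarrow> neg_powr \<gamma> t \<le> neg_powr \<gamma> s"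
  by (auto simp: neg_powr_def intro!: ennreal_leI powr_mono2')

lemma neg_powr_power: "0 < n \<Longrightarrow> neg_powr \<gamma> s ^ n = neg_powr (real n * \<gamma>) s"
  by (induction n rule: nat_induct_non_zero) (simp_all add: neg_powr_add[symmetric] algebra_simps)

lemma prod_mono_ennreal:
  fixes f g :: "'i \<Rightarrow> ennreal"
  assumes "\<And>i. i \<in> I \<Longrightarrow> f i \<le> g i"
  shows "prod f I \<le> prod g I"
  using assms by (induction I rule: infinite_finite_induct) (auto intro: mult_mono)

text \<open>Splits the exponent evenly over \<open>I\<close> and shrinks each base: the device that
  turns powers of Euclidean norms into products over coordinates. An empty \<open>I\<close> must be
  excluded, because \<open>neg_powr 0 0\<close> is \<open>top\<close> and an empty product is
  1.\<close>

lemma neg_powr_le_prod: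
  assumes "finite I" "I \<noteq> {}" "0 \<le> \<gamma>" "\<And>i. i \<in> I \<Longrightarrow> \<bar>s i\<bar> \<le> \<bar>t\<bar>"
  shows "neg_powr (real (card I) * \<gamma>) t \<le> (\<Prod>i\<in>I. neg_powr \<gamma> (s i))"
proof -
  have "neg_powr (real (card I) * \<gamma>) t = (\<Prod>i\<in>I. neg_powr \<gamma> t)"
    using assms by (simp add: neg_powr_power card_gt_0_iff)
  also have "\<dots> \<le> (\<Prod>i\<in>I. neg_powr \<gamma> (s i))"
    using assms by (intro prod_mono_ennreal neg_powr_antimono) auto
  finally show ?thesis .
qed

text \<open>In dimension 1 the exponent would be 0, where \<open>weight 0 = 1\<close> but
  \<open>neg_powr 0 0 = top\<close>.\<close>

lemma weight_eq_neg_powr: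
  assumes "2 \<le> CARD('n)"
  shows "weight (x :: real ^ 'n) = neg_powr (real (CARD('n) - 1)) (norm x)"
proof (cases "x = 0")
  case True
  then show ?thesis using assms by (simp add: weight_def neg_powr_def)
next
  case False
  then have "norm x ^ (CARD('n) - 1) = norm x powr real (CARD('n) - 1)"
    by (intro powr_realpow[symmetric]) simp
  with False show ?thesis
    by (simp add: weight_def neg_powr_def ennreal_power inverse_ennreal flip: powr_minus)
qed

text \<open>The one-variable model: a singularity of order \<open>\<gamma>\<close> at 0, and decay
  of total order \<open>\<gamma> + \<beta>\<close> beyond the scale \<open>W\<close>.\<close>

definition pole :: "real \<Rightarrow> real \<Rightarrow> real \<Rightarrow> real \<Rightarrow> ennreal" where
  "pole \<gamma> \<beta> W s = neg_powr \<gamma> s * neg_powr \<beta> (max W \<bar>s\<bar>)"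

lemma pole_measurable [measurable]: "pole \<gamma> \<beta> W \<in> borel_measurable borel"
  unfolding pole_def by measurable

text \<open>Split at \<open>\<bar>s\<bar> = W\<close>. Both pieces scale like
  \<open>W powr - (\<gamma> + \<beta> - 1)\<close>, with coefficient
  \<open>1 / (1 - \<gamma>)\<close> near 0 and \<open>1 / (\<gamma> + \<beta> - 1)\<close> at
  infinity; the factor 2 stands for the two signs of \<open>s\<close>.\<close>

lemma nn_integral_pole_le:
  assumes W: "0 < W" and \<gamma>: "\<gamma> < 1" and \<beta>: "1 < \<gamma> + \<beta>"
  shows "(\<integral>\<^sup>+s. pole \<gamma> \<beta> W s \<partial>lborel)
    \<le> ennreal (2 / (1 - \<gamma>) + 2 / (\<gamma> + \<beta> - 1)) * neg_powr (\<gamma> + \<beta> - 1) W"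
proof -
  define A where "A s = ennreal (W powr - \<beta> * s powr - \<gamma>) * indicator {0..W} s
    + ennreal (s powr - (\<gamma> + \<beta>)) * indicator {W..} s" for s :: real
  have [measurable]: "A \<in> borel_measurable borel" unfolding A_def by measurable
  have "((\<lambda>s. W powr - \<beta> * s powr - \<gamma>) has_integral (W powr - \<beta> * (W powr (- \<gamma> + 1) / (- \<gamma> + 1)))) {0..W}"
    using has_integral_powr_from_0[of "- \<gamma>" W] W \<gamma> by (intro has_integral_mult_right) auto
  then have I1: "(\<integral>\<^sup>+s. ennreal (W powr - \<beta> * s powr - \<gamma>) * indicator {0..W} s \<partial>lborel)
      = ennreal (W powr - \<beta> * (W powr (- \<gamma> + 1) / (- \<gamma> + 1)))"
    by (intro nn_integral_has_integral_lebesgue') auto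
  have "((\<lambda>s. s powr - (\<gamma> + \<beta>)) has_integral - (W powr (- (\<gamma> + \<beta>) + 1)) / (- (\<gamma> + \<beta>) + 1)) {W..}"
    using W \<beta> by (intro has_integral_powr_to_inf) auto
  then have I2: "(\<integral>\<^sup>+s. ennreal (s powr - (\<gamma> + \<beta>)) * indicator {W..} s \<partial>lborel)
      = ennreal (- (W powr (- (\<gamma> + \<beta>) + 1)) / (- (\<gamma> + \<beta>) + 1))"
    by (intro nn_integral_has_integral_lebesgue') auto
  have "(\<integral>\<^sup>+s. A s \<partial>lborel) = ennreal (W powr - \<beta> * (W powr (- \<gamma> + 1) / (- \<gamma> + 1)))
      + ennreal (- (W powr (- (\<gamma> + \<beta>) + 1)) / (- (\<gamma> + \<beta>) + 1))"
    unfolding A_def I1[symmetric] I2[symmetric] by (intro nn_integral_add) auto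
  also have "\<dots> = ennreal (W powr - \<beta> * (W powr (- \<gamma> + 1) / (- \<gamma> + 1))
       + - (W powr (- (\<gamma> + \<beta>) + 1)) / (- (\<gamma> + \<beta>) + 1))"
    using \<gamma> \<beta> by (intro ennreal_plus[symmetric]) (auto simp: divide_nonneg_neg)
  also have "W powr - \<beta> * (W powr (- \<gamma> + 1) / (- \<gamma> + 1)) = (1 / (1 - \<gamma>)) * W powr - (\<gamma> + \<beta> - 1)"
    by (simp add: powr_add[symmetric] algebra_simps)
  also have "- (W powr (- (\<gamma> + \<beta>) + 1)) / (- (\<gamma> + \<beta>) + 1) = (1 / (\<gamma> + \<beta> - 1)) * W powr - (\<gamma> + \<beta> - 1)"
    using \<beta> by (simp add: field_simps)
  finally have IA: "(\<integral>\<^sup>+s. A s \<partial>lborel)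
      = ennreal (1 / (1 - \<gamma>) + 1 / (\<gamma> + \<beta> - 1)) * neg_powr (\<gamma> + \<beta> - 1) W"
    using W \<gamma> \<beta> by (simp add: neg_powr_eq ennreal_mult[symmetric] distrib_right)
  have IA': "(\<integral>\<^sup>+s. A (- s) \<partial>lborel) = (\<integral>\<^sup>+s. A s \<partial>lborel)"
    using nn_integral_real_affine[of A "-1" 0] by simp
  have A_ge: "pole \<gamma> \<beta> W s \<le> A s" if "0 < s" for s
  proof (cases "s \<le> W")
    case True
    with that have "pole \<gamma> \<beta> W s = ennreal (W powr - \<beta> * s powr - \<gamma>)"
      by (simp add: pole_def neg_powr_eq ennreal_mult[symmetric] mult.commute)
    with that True show ?thesis by (simp add: A_def)
  next
    case False
    with that have "pole \<gamma> \<beta> W s = ennreal (s powr - (\<gamma> + \<beta>))"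
      by (simp add: pole_def neg_powr_eq ennreal_mult[symmetric] powr_add[symmetric])
    with that False show ?thesis by (simp add: A_def)
  qed
  \<comment> \<open>At \<open>s = 0\<close> the pole is infinite while \<open>A\<close> is finite,
    so the comparison is made almost everywhere.\<close>
  have "AE s in lborel. s \<noteq> (0::real)"
    by (rule AE_lborel_singleton)
  then have "AE s in lborel. pole \<gamma> \<beta> W s \<le> A s + A (- s)"
  proof eventually_elim
    fix s :: real assume "s \<noteq> 0"
    moreover have "pole \<gamma> \<beta> W (- s) = pole \<gamma> \<beta> W s" by (simp add: pole_def)
    ultimately show "pole \<gamma> \<beta> W s \<le> A s + A (- s)"
      using A_ge[of s] A_ge[of "- s"] by (cases "0 < s") (auto intro: add_increasing add_increasing2)
  qed
  then have "(\<integral>\<^sup>+s. pole \<gamma> \<beta> W s \<partial>lborel) \<le> (\<integral>\<^sup>+s. A s + A (- s) \<partial>lborel)"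
    by (rule nn_integral_mono_AE)
  also have "\<dots> = 2 * (\<integral>\<^sup>+s. A s \<partial>lborel)"
    by (simp add: nn_integral_add IA' flip: mult_2)
  also have "\<dots> = ennreal (2 / (1 - \<gamma>) + 2 / (\<gamma> + \<beta> - 1)) * neg_powr (\<gamma> + \<beta> - 1) W"
  proof -
    have "2 * (1 / (1 - \<gamma>) + 1 / (\<gamma> + \<beta> - 1)) = 2 / (1 - \<gamma>) + 2 / (\<gamma> + \<beta> - 1)"
      by (simp add: distrib_left)
    then have "ennreal (2 / (1 - \<gamma>) + 2 / (\<gamma> + \<beta> - 1)) = 2 * ennreal (1 / (1 - \<gamma>) + 1 / (\<gamma> + \<beta> - 1))"
      by (metis ennreal_mult' ennreal_numeral zero_le_numeral)
    then show ?thesis by (simp only: IA mult.assoc)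
  qed
  finally show ?thesis .
qed

lemma nn_integral_shift:
  fixes f :: "real \<Rightarrow> ennreal"
  assumes "f \<in> borel_measurable borel"
  shows "(\<integral>\<^sup>+s. f (s - c) \<partial>lborel) = (\<integral>\<^sup>+s. f s \<partial>lborel)"
  using nn_integral_real_affine[OF assms, of 1 "- c"] by simp

text \<open>Large enough for a single pole of order \<open>\<gamma>\<close> and for two poles of
  order \<open>\<gamma> + \<epsilon>\<close>.\<close>

definition pole_const :: "real \<Rightarrow> real \<Rightarrow> real \<Rightarrow> real" where
  "pole_const \<gamma> \<beta> \<epsilon> = 4 / (1 - \<gamma> - \<epsilon>) + 4 / (\<gamma> + \<beta> - 1)"

text \<open>\<open>\<gamma> + \<epsilon> < 1\<close> keeps a pole integrable at 0 even after an
  extra singular factor of order \<open>\<epsilon>\<close> has merged with it;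
  \<open>1 < \<gamma> + \<beta>\<close> gives integrability at infinity.\<close>

locale pole_exponents =
  fixes \<gamma> \<beta> \<epsilon> W :: real
  assumes exps: "0 < W" "0 \<le> \<gamma>" "0 \<le> \<beta>" "0 \<le> \<epsilon>" "\<gamma> + \<epsilon> < 1" "1 < \<gamma> + \<beta>"
begin

definition pole_bound :: ennreal where "pole_bound = ennreal (pole_const \<gamma> \<beta> \<epsilon>) * neg_powr (\<gamma> + \<beta> - 1) W"

lemma nn_integral_pole_le_bound: "(\<integral>\<^sup>+s. pole \<gamma> \<beta> W s \<partial>lborel) \<le> pole_bound"
proof -
  have "2 / (1 - \<gamma>) \<le> 4 / (1 - \<gamma> - \<epsilon>)"
    using exps by (intro frac_le) auto
  moreover have "2 / (\<gamma> + \<beta> - 1) \<le> 4 / (\<gamma> + \<beta> - 1)"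
    using exps by (intro divide_right_mono) auto
  ultimately show ?thesis
    unfolding pole_bound_def pole_const_def using exps
    by (intro order_trans[OF nn_integral_pole_le] mult_right_mono ennreal_leI add_mono) auto
qed

text \<open>Of the two singularities, the nearer one dominates.\<close>

lemma nn_integral_pole_singular_le:
  "(\<integral>\<^sup>+s. pole \<gamma> \<beta> W s * neg_powr \<epsilon> (c + a * s) \<partial>lborel) \<le> pole_bound * neg_powr \<epsilon> W * neg_powr \<epsilon> a"
proof (cases "a = 0")
  case True
  \<comment> \<open>For \<open>a = 0\<close> the right side is infinite, since
    \<open>neg_powr \<epsilon> 0 = top\<close> is multiplied by nonzero factors.\<close>
  have "pole_bound \<noteq> 0"
    using exps by (simp add: pole_bound_def pole_const_def ennreal_eq_0_iff not_le add_pos_pos)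
  with True show ?thesis by (simp add: neg_powr_def ennreal_mult_top)
next
  case False
  \<comment> \<open>The root of the affine function, which therefore equals
    \<open>a * (s - t)\<close>.\<close>
  define t where "t = - c / a"
  have dom: "pole \<gamma> \<beta> W s * neg_powr \<epsilon> (s - t) \<le> pole (\<gamma> + \<epsilon>) \<beta> W s + pole (\<gamma> + \<epsilon>) \<beta> W (s - t)" for s
  proof (cases "\<bar>s\<bar> \<le> \<bar>s - t\<bar>")
    case True
    then have "pole \<gamma> \<beta> W s * neg_powr \<epsilon> (s - t) \<le> pole \<gamma> \<beta> W s * neg_powr \<epsilon> s"
      using exps by (intro mult_left_mono neg_powr_antimono) auto
    also have "\<dots> = pole (\<gamma> + \<epsilon>) \<beta> W s"
      by (simp add: pole_def neg_powr_add ac_simps)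
    finally show ?thesis by (rule add_increasing2[rotated]) simp
  next
    case False
    then have "pole \<gamma> \<beta> W s \<le> pole \<gamma> \<beta> W (s - t)"
      unfolding pole_def using exps by (intro mult_mono neg_powr_antimono) auto
    then have "pole \<gamma> \<beta> W s * neg_powr \<epsilon> (s - t) \<le> pole \<gamma> \<beta> W (s - t) * neg_powr \<epsilon> (s - t)"
      by (intro mult_right_mono) auto
    also have "\<dots> = pole (\<gamma> + \<epsilon>) \<beta> W (s - t)"
      by (simp add: pole_def neg_powr_add ac_simps)
    finally show ?thesis by (rule add_increasing[rotated]) simp
  qed
  let ?K = "2 / (1 - (\<gamma> + \<epsilon>)) + 2 / ((\<gamma> + \<epsilon>) + \<beta> - 1)"
  have "(\<integral>\<^sup>+s. pole \<gamma> \<beta> W s * neg_powr \<epsilon> (s - t) \<partial>lborel)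
      \<le> (\<integral>\<^sup>+s. pole (\<gamma> + \<epsilon>) \<beta> W s + pole (\<gamma> + \<epsilon>) \<beta> W (s - t) \<partial>lborel)"
    by (intro nn_integral_mono dom)
  also have "\<dots> = 2 * (\<integral>\<^sup>+s. pole (\<gamma> + \<epsilon>) \<beta> W s \<partial>lborel)"
    by (simp add: nn_integral_add nn_integral_shift flip: mult_2)
  also have "\<dots> \<le> 2 * (ennreal ?K * neg_powr ((\<gamma> + \<epsilon>) + \<beta> - 1) W)"
    using exps by (intro mult_left_mono nn_integral_pole_le) auto
  also have "\<dots> = ennreal (2 * ?K) * neg_powr ((\<gamma> + \<beta> - 1) + \<epsilon>) W"
    by (simp only: ennreal_mult'[of 2, simplified] mult.assoc) (simp add: ac_simps add_diff_eq)
  also have "\<dots> \<le> ennreal (pole_const \<gamma> \<beta> \<epsilon>) * neg_powr ((\<gamma> + \<beta> - 1) + \<epsilon>) W"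
  proof (intro mult_right_mono ennreal_leI)
    have "4 / ((\<gamma> + \<epsilon>) + \<beta> - 1) \<le> 4 / (\<gamma> + \<beta> - 1)"
      using exps by (intro divide_left_mono) auto
    then show "2 * ?K \<le> pole_const \<gamma> \<beta> \<epsilon>"
      by (simp add: pole_const_def diff_diff_eq)
  qed simp
  finally have "(\<integral>\<^sup>+s. pole \<gamma> \<beta> W s * neg_powr \<epsilon> (s - t) \<partial>lborel) \<le> pole_bound * neg_powr \<epsilon> W"
    by (simp add: pole_bound_def neg_powr_add mult.assoc)
  moreover have "neg_powr \<epsilon> (c + a * s) = neg_powr \<epsilon> (s - t) * neg_powr \<epsilon> a" for s
  proof -
    have "(s - t) * a = c + a * s"
      using False by (simp add: t_def field_simps)
    then show ?thesis by (simp flip: neg_powr_mult)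
  qed
  then have "(\<integral>\<^sup>+s. pole \<gamma> \<beta> W s * neg_powr \<epsilon> (c + a * s) \<partial>lborel)
      = (\<integral>\<^sup>+s. pole \<gamma> \<beta> W s * neg_powr \<epsilon> (s - t) * neg_powr \<epsilon> a \<partial>lborel)"
    by (simp add: mult.assoc)
  then have "(\<integral>\<^sup>+s. pole \<gamma> \<beta> W s * neg_powr \<epsilon> (c + a * s) \<partial>lborel)
      = (\<integral>\<^sup>+s. pole \<gamma> \<beta> W s * neg_powr \<epsilon> (s - t) \<partial>lborel) * neg_powr \<epsilon> a"
    by (simp add: nn_integral_multc)
  ultimately show ?thesis
    by (simp add: mult_right_mono)
qed

end

section \<open>Lebesgue measure on blocks of coordinates\<close>

lemma measurable_vec_nth [measurable]:
  "(\<lambda>x :: 'a::euclidean_space ^ 'm. x $ i) \<in> borel_measurable borel"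
  by (intro borel_measurable_continuous_onI continuous_intros)

lemma measurable_vec_lambda [measurable]:
  "(vec_lambda :: _ \<Rightarrow> 'a::euclidean_space ^ 'm) \<in> (\<Pi>\<^sub>M i\<in>UNIV. borel) \<rightarrow>\<^sub>M borel"
proof -
  have "(\<lambda>x. (vec_lambda x :: 'a ^ 'm) \<bullet> b) \<in> borel_measurable (\<Pi>\<^sub>M i\<in>UNIV. borel)" if b: "b \<in> Basis" for b
  proof -
    obtain i u where "b = axis i u" using b by (auto simp: Basis_vec_def)
    then have "(\<lambda>x. (vec_lambda x :: 'a ^ 'm) \<bullet> b) = (\<lambda>x. x i \<bullet> u)"
      by (simp add: inner_axis)
    then show ?thesis by simp
  qed
  then show ?thesis
    by (subst borel_measurable_euclidean_space) auto
qed

lemma prod_Basis_vec: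
  "(\<Prod>b\<in>(Basis :: ('a::euclidean_space ^ 'm) set). f b) = (\<Prod>k\<in>UNIV. \<Prod>u\<in>Basis. f (axis k u))"
proof -
  have "bij_betw (\<lambda>(k, u). axis k u) (UNIV \<times> Basis) (Basis :: ('a ^ 'm) set)"
    by (auto simp: bij_betw_def inj_on_def Basis_vec_def axis_eq_axis)
  then have "(\<Prod>b\<in>(Basis :: ('a ^ 'm) set). f b) = (\<Prod>(k, u)\<in>UNIV \<times> Basis. f (axis k u))"
    by (simp add: prod.reindex_bij_betw[symmetric] split_def)
  then show ?thesis
    by (simp add: prod.cartesian_product)
qed

text \<open>Lebesgue measure is determined by its values on boxes, and these factor over the
  components. The component type is used both as \<open>real\<close>, for the coordinates of one
  vector, and as \<open>real ^ 'n\<close>, for the blocks of a configuration.\<close>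

lemma lborel_vec:
  "(lborel :: ('a::euclidean_space ^ 'm) measure) = distr (\<Pi>\<^sub>M i\<in>UNIV. lborel) borel vec_lambda"
proof (rule lborel_eqI)
  interpret product_sigma_finite "\<lambda>_ :: 'm. lborel :: 'a measure"
    by unfold_locales
  fix l u :: "'a ^ 'm"
  assume le: "\<And>b. b \<in> Basis \<Longrightarrow> l \<bullet> b \<le> u \<bullet> b"
  have le': "l $ k \<bullet> b \<le> u $ k \<bullet> b" if "b \<in> Basis" for k b
    using le[of "axis k b"] that by (simp add: inner_axis)
  have "vec_lambda -` box l u \<inter> space (\<Pi>\<^sub>M i\<in>UNIV. lborel) = (\<Pi>\<^sub>E k\<in>UNIV. box (l $ k) (u $ k))"
    by (auto simp: mem_box Basis_vec_def inner_axis space_PiM PiE_def Pi_def)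
  then have "emeasure (distr (\<Pi>\<^sub>M i\<in>UNIV. lborel) borel vec_lambda) (box l u)
      = (\<Prod>k\<in>UNIV. emeasure lborel (box (l $ k) (u $ k)))"
    by (simp add: emeasure_distr emeasure_PiM)
  also have "\<dots> = (\<Prod>k\<in>UNIV. ennreal (\<Prod>b\<in>Basis. (u $ k - l $ k) \<bullet> b))"
    using le' by simp
  also have "\<dots> = ennreal (\<Prod>k\<in>UNIV. \<Prod>b\<in>Basis. (u $ k - l $ k) \<bullet> b)"
    using le' by (intro prod_ennreal prod_nonneg) (auto simp: inner_diff_left)
  also have "\<dots> = ennreal (\<Prod>b\<in>Basis. (u - l) \<bullet> b)"
    by (simp add: prod_Basis_vec inner_axis)
  finally show "emeasure (distr (\<Pi>\<^sub>M i\<in>UNIV. lborel) borel vec_lambda) (box l u)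
      = ennreal (\<Prod>b\<in>Basis. (u - l) \<bullet> b)" .
qed simp

lemma nn_integral_vec:
  fixes f :: "'a::euclidean_space ^ 'm \<Rightarrow> ennreal"
  assumes [measurable]: "f \<in> borel_measurable borel"
  shows "(\<integral>\<^sup>+X. f X \<partial>lborel) = (\<integral>\<^sup>+x. f (vec_lambda x) \<partial>(\<Pi>\<^sub>M i\<in>UNIV. lborel))"
  by (simp add: lborel_vec nn_integral_distr)

lemma product_sigma_finite_lborel: "product_sigma_finite (\<lambda>_. lborel :: 'a::euclidean_space measure)"
  by unfold_locales

lemma nn_integral_vec_prod:
  fixes f :: "'m::finite \<Rightarrow> 'a::euclidean_space \<Rightarrow> ennreal"
  assumes [measurable]: "\<And>i. f i \<in> borel_measurable borel"
  shows "(\<integral>\<^sup>+X. (\<Prod>i\<in>UNIV. f i (X $ i)) \<partial>lborel) = (\<Prod>i\<in>UNIV. \<integral>\<^sup>+x. f i x \<partial>lborel)"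
proof -
  have "(\<integral>\<^sup>+X. (\<Prod>i\<in>UNIV. f i (X $ i)) \<partial>lborel)
      = (\<integral>\<^sup>+x. (\<Prod>i\<in>UNIV. f i (vec_lambda x $ i)) \<partial>(\<Pi>\<^sub>M i\<in>UNIV. lborel))"
    by (rule nn_integral_vec) measurable
  also have "\<dots> = (\<integral>\<^sup>+x. (\<Prod>i\<in>UNIV. f i (x i)) \<partial>(\<Pi>\<^sub>M i\<in>UNIV. lborel))"
    by simp
  also have "\<dots> = (\<Prod>i\<in>UNIV. \<integral>\<^sup>+x. f i x \<partial>lborel)"
    by (rule product_sigma_finite.product_nn_integral_prod[OF product_sigma_finite_lborel]) auto
  finally show ?thesis .
qed

lemma nn_integral_vec_split:
  fixes f :: "'a::euclidean_space ^ 'm \<Rightarrow> ennreal"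
  assumes [measurable]: "f \<in> borel_measurable borel"
  shows "(\<integral>\<^sup>+X. f X \<partial>lborel)
    = (\<integral>\<^sup>+x. (\<integral>\<^sup>+z. f (vec_lambda (x(k := z))) \<partial>lborel) \<partial>(\<Pi>\<^sub>M i\<in>UNIV - {k}. lborel))"
proof -
  have "insert k (UNIV - {k}) = UNIV" by auto
  moreover have "(\<lambda>x. f (vec_lambda x)) \<in> borel_measurable (\<Pi>\<^sub>M i\<in>UNIV. lborel)" by measurable
  ultimately show ?thesis
    using product_sigma_finite.product_nn_integral_insert[OF product_sigma_finite_lborel,
        of "UNIV - {k}" k "\<lambda>x. f (vec_lambda x)"]
    by (simp add: nn_integral_vec)
qed

section \<open>Products of poles over the coordinates of one vector\<close>

context pole_exponents
begin

definition vpole :: "real ^ 'n \<Rightarrow> ennreal" where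
  "vpole x = (\<Prod>l\<in>UNIV. pole \<gamma> \<beta> W (x $ l))"

lemma vpole_measurable [measurable]: "vpole \<in> borel_measurable borel"
  unfolding vpole_def by measurable

lemma nn_integral_vpole_le: "(\<integral>\<^sup>+x. vpole (x :: real ^ 'n) \<partial>lborel) \<le> pole_bound ^ CARD('n)"
proof -
  have "(\<integral>\<^sup>+x. vpole (x :: real ^ 'n) \<partial>lborel) = (\<Prod>l\<in>(UNIV :: 'n set). \<integral>\<^sup>+s. pole \<gamma> \<beta> W s \<partial>lborel)"
    unfolding vpole_def by (rule nn_integral_vec_prod) measurable
  also have "\<dots> \<le> (\<Prod>l\<in>(UNIV :: 'n set). pole_bound)"
    by (intro prod_mono_ennreal nn_integral_pole_le_bound)
  finally show ?thesis by simp
qed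

text \<open>The one-variable bound is applied in the coordinate \<open>l\<close> where
  \<open>\<bar>v $ l\<bar>\<close> is largest, the others being plain poles. There
  \<open>norm v\<close> is at most \<open>CARD('n) * \<bar>v $ l\<bar>\<close>, which costs the
  factor \<open>CARD('n) powr \<epsilon>\<close>.\<close>

lemma nn_integral_vpole_singular_le:
  fixes v :: "real ^ 'n"
  shows "(\<integral>\<^sup>+x. vpole x * neg_powr \<epsilon> (c + v \<bullet> x) \<partial>lborel)
    \<le> ennreal (CARD('n) powr \<epsilon>) * pole_bound ^ CARD('n) * neg_powr \<epsilon> W * neg_powr \<epsilon> (norm v)"
proof -
  have "Max (range (\<lambda>l. \<bar>v $ l\<bar>)) \<in> range (\<lambda>l. \<bar>v $ l\<bar>)"
    by (rule Max_in) auto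
  then obtain l where l: "Max (range (\<lambda>l. \<bar>v $ l\<bar>)) = \<bar>v $ l\<bar>" by (rule imageE)
  have max: "\<bar>v $ i\<bar> \<le> \<bar>v $ l\<bar>" for i
    unfolding l[symmetric] by (rule Max_ge) auto
  have "norm v \<le> (\<Sum>i\<in>UNIV. \<bar>v $ i\<bar>)" by (rule norm_le_l1_cart)
  also have "\<dots> \<le> (\<Sum>i\<in>(UNIV :: 'n set). \<bar>v $ l\<bar>)" by (intro sum_mono max)
  finally have vl: "norm v \<le> CARD('n) * \<bar>v $ l\<bar>" by simp
  let ?P = "\<Pi>\<^sub>M i\<in>UNIV - {l}. lborel :: real measure"
  have upd: "vpole (vec_lambda (x(l := s))) * neg_powr \<epsilon> (c + v \<bullet> vec_lambda (x(l := s)))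
      = (\<Prod>i\<in>UNIV - {l}. pole \<gamma> \<beta> W (x i)) *
        (pole \<gamma> \<beta> W s * neg_powr \<epsilon> ((c + (\<Sum>i\<in>UNIV - {l}. v $ i * x i)) + v $ l * s))" for x s
  proof -
    have "vpole (vec_lambda (x(l := s)) :: real ^ 'n) = pole \<gamma> \<beta> W s * (\<Prod>i\<in>UNIV - {l}. pole \<gamma> \<beta> W (x i))"
      unfolding vpole_def by (subst prod.remove[of _ l]) auto
    moreover have "v \<bullet> vec_lambda (x(l := s)) = v $ l * s + (\<Sum>i\<in>UNIV - {l}. v $ i * x i)"
      unfolding inner_vec_def by (subst sum.remove[of _ l]) auto
    ultimately show ?thesis by (simp add: ac_simps)
  qed
  have "(\<integral>\<^sup>+x. vpole x * neg_powr \<epsilon> (c + v \<bullet> x) \<partial>lborel)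
      = (\<integral>\<^sup>+x. (\<integral>\<^sup>+s. vpole (vec_lambda (x(l := s))) * neg_powr \<epsilon> (c + v \<bullet> vec_lambda (x(l := s))) \<partial>lborel) \<partial>?P)"
    by (rule nn_integral_vec_split) measurable
  also have "\<dots> = (\<integral>\<^sup>+x. (\<Prod>i\<in>UNIV - {l}. pole \<gamma> \<beta> W (x i)) *
      (\<integral>\<^sup>+s. pole \<gamma> \<beta> W s * neg_powr \<epsilon> ((c + (\<Sum>i\<in>UNIV - {l}. v $ i * x i)) + v $ l * s) \<partial>lborel) \<partial>?P)"
    unfolding upd by (simp add: nn_integral_cmult)
  also have "\<dots> \<le> (\<integral>\<^sup>+x. (\<Prod>i\<in>UNIV - {l}. pole \<gamma> \<beta> W (x i)) * (pole_bound * neg_powr \<epsilon> W * neg_powr \<epsilon> (v $ l)) \<partial>?P)"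
    by (intro nn_integral_mono mult_left_mono nn_integral_pole_singular_le) simp
  also have "\<dots> = (\<integral>\<^sup>+x. (\<Prod>i\<in>UNIV - {l}. pole \<gamma> \<beta> W (x i)) \<partial>?P) * (pole_bound * neg_powr \<epsilon> W * neg_powr \<epsilon> (v $ l))"
    by (rule nn_integral_multc) measurable
  also have "(\<integral>\<^sup>+x. (\<Prod>i\<in>UNIV - {l}. pole \<gamma> \<beta> W (x i)) \<partial>?P)
      = (\<Prod>i\<in>UNIV - {l}. \<integral>\<^sup>+s. pole \<gamma> \<beta> W s \<partial>lborel)"
    by (rule product_sigma_finite.product_nn_integral_prod[OF product_sigma_finite_lborel]) auto
  also have "\<dots> \<le> (\<Prod>i\<in>UNIV - {l}. pole_bound)"
    by (intro prod_mono_ennreal nn_integral_pole_le_bound)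
  also have "\<dots> * (pole_bound * neg_powr \<epsilon> W * neg_powr \<epsilon> (v $ l)) = pole_bound ^ CARD('n) * neg_powr \<epsilon> W * neg_powr \<epsilon> (v $ l)"
  proof -
    have "(\<Prod>i\<in>UNIV - {l}. pole_bound) * pole_bound = (\<Prod>i\<in>(UNIV :: 'n set). pole_bound)"
      by (subst prod.remove[of UNIV l]) (auto simp: mult.commute)
    then show ?thesis by (simp add: mult.assoc[symmetric] del: prod_constant) simp
  qed
  also have "neg_powr \<epsilon> (v $ l) \<le> ennreal (CARD('n) powr \<epsilon>) * neg_powr \<epsilon> (norm v)"
  proof (cases "v $ l = 0")
    case True
    then have "norm v = 0" using vl by simp
    then show ?thesis by (simp add: neg_powr_def ennreal_mult_top)
  next
    case False
    then have "norm v \<noteq> 0" by auto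
    have "neg_powr \<epsilon> (v $ l) = ennreal (CARD('n) powr \<epsilon>) * neg_powr \<epsilon> (CARD('n) * v $ l)"
    proof -
      have "ennreal (CARD('n) powr \<epsilon>) * neg_powr \<epsilon> (CARD('n)) = 1"
        by (simp add: neg_powr_eq ennreal_mult[symmetric] powr_add[symmetric])
      then show ?thesis
        by (simp add: neg_powr_mult mult.assoc[symmetric])
    qed
    also have "\<dots> \<le> ennreal (CARD('n) powr \<epsilon>) * neg_powr \<epsilon> (norm v)"
      using vl exps by (intro mult_left_mono neg_powr_antimono) (auto simp: abs_mult)
    finally show ?thesis .
  qed
  finally show ?thesis by (simp add: mult_left_mono mult_right_mono ac_simps)
qed

end

section \<open>The quadratic constraint\<close>

definition quadric :: "real ^ 'n \<Rightarrow> real ^ 'n ^ 'm \<Rightarrow> real" where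
  "quadric w X = 1 + (\<Sum>k\<in>UNIV. norm (X $ k) ^ 2) - norm (w - (\<Sum>k\<in>UNIV. X $ k)) ^ 2"

definition quadric_grad :: "real ^ 'n \<Rightarrow> real ^ 'n ^ 'm \<Rightarrow> real ^ 'n ^ 'm" where
  "quadric_grad w X = (\<chi> k. 2 *\<^sub>R (X $ k + (w - (\<Sum>j\<in>UNIV. X $ j))))"

definition quadric_weight :: "real ^ 'n \<Rightarrow> real ^ 'n ^ 'm \<Rightarrow> ennreal" where
  "quadric_weight w X = (\<Prod>k\<in>UNIV. weight (X $ k)) * weight (w - (\<Sum>k\<in>UNIV. X $ k))"

lemma GDERIV_quadric: "GDERIV (quadric w) X :> quadric_grad w X"
proof -
  have nth: "((\<lambda>X. X $ k) has_derivative (\<lambda>H. H $ k)) (at X)" for k :: 'b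
    by (rule bounded_linear_imp_has_derivative[OF bounded_linear_vec_nth])
  show ?thesis
    unfolding gderiv_def quadric_def power2_norm_eq_inner
    apply (rule derivative_eq_intros nth refl)+
    apply (simp add: fun_eq_iff quadric_grad_def inner_vec_def[of "_ :: (real ^ 'a) ^ 'b"] inner_simps inner_commute sum.distrib
        sum_subtractf sum_distrib_left algebra_simps inner_sum_left inner_sum_right)
    by (intro allI sum.swap)
qed

text \<open>The trapezoidal rule is exact for quadratic functions; concretely, every difference of
  squared norms factors as \<open>(a + b) \<bullet> (a - b)\<close>.\<close>

lemma quadric_diff:
  "2 * (quadric w Y - quadric w X) = (quadric_grad w X + quadric_grad w Y) \<bullet> (Y - X)"
proof -
  define s t where "s = w - (\<Sum>j\<in>UNIV. X $ j)" and "t = w - (\<Sum>j\<in>UNIV. Y $ j)"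
  have sq: "norm a ^ 2 - norm b ^ 2 = (a + b) \<bullet> (a - b)" for a b :: "real ^ 'n"
    by (simp add: power2_norm_eq_inner inner_simps inner_commute)
  have st: "s - t = (\<Sum>j\<in>UNIV. Y $ j - X $ j)"
    by (simp add: s_def t_def sum_subtractf)
  have "quadric w Y - quadric w X = (\<Sum>k\<in>UNIV. norm (Y $ k) ^ 2 - norm (X $ k) ^ 2) + (norm s ^ 2 - norm t ^ 2)"
    by (simp add: quadric_def s_def t_def sum_subtractf)
  also have "\<dots> = (\<Sum>k\<in>UNIV. (Y $ k + X $ k) \<bullet> (Y $ k - X $ k)) + (s + t) \<bullet> (\<Sum>j\<in>UNIV. Y $ j - X $ j)"
    by (simp only: sq st)
  also have "\<dots> = (\<Sum>k\<in>UNIV. (Y $ k + X $ k + (s + t)) \<bullet> (Y $ k - X $ k))"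
    by (simp add: inner_sum_right sum.distrib inner_add_left)
  also have "2 * \<dots> = (\<Sum>k\<in>UNIV. (2 *\<^sub>R (X $ k + s) + 2 *\<^sub>R (Y $ k + t)) \<bullet> (Y $ k - X $ k))"
    unfolding sum_distrib_left by (intro sum.cong refl) (simp add: inner_simps algebra_simps)
  finally show ?thesis
    by (simp add: inner_vec_def[of "_ :: (real ^ 'n) ^ 'm"] quadric_grad_def s_def t_def)
qed

lemma sum_axis: "(\<Sum>j\<in>UNIV. axis k u $ j) = (u :: 'a::real_vector)"
  by (simp add: axis_def)

text \<open>A shift along a coordinate of block \<open>k\<close> changes \<open>X $ k\<close> and
  the sum of all blocks equally, and these enter the gradient with opposite signs: the squares of
  that coordinate cancel in \<open>quadric\<close>.\<close>

lemma quadric_grad_diag: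
  assumes "e \<in> Basis"
  shows "quadric_grad w (X + t *\<^sub>R e) \<bullet> e = quadric_grad w X \<bullet> e"
proof -
  obtain k u where e: "e = axis k u"
    using assms by (auto simp: Basis_vec_def)
  show ?thesis
    by (simp add: e quadric_grad_def inner_axis sum.distrib sum_axis flip: scaleR_sum_right)
qed

text \<open>At a critical point every block equals \<open>- s\<close>, so the quadric has the value
  \<open>1 + (m - 1) * norm s ^ 2\<close> with \<open>m = CARD('m)\<close>, which is
  positive.\<close>

lemma quadric_grad_nonzero:
  fixes X :: "real ^ 'n ^ 'm"
  assumes "quadric w X = 0"
  shows "quadric_grad w X \<noteq> 0"
proof
  assume 0: "quadric_grad w X = 0"
  define s where "s = w - (\<Sum>j\<in>UNIV. X $ j)"
  have "X $ k + s = 0" for k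
    using arg_cong[OF 0, of "\<lambda>Y. Y $ k"] by (simp add: quadric_grad_def s_def)
  then have X: "norm (X $ k) = norm s" for k
    by (metis add_eq_0_iff norm_minus_cancel)
  have "quadric w X = 1 + real CARD('m) * norm s ^ 2 - norm s ^ 2"
    by (simp add: quadric_def X flip: s_def)
  moreover have "1 * norm s ^ 2 \<le> real CARD('m) * norm s ^ 2"
    by (intro mult_right_mono) (simp_all add: Suc_leI)
  ultimately show False using assms by simp
qed

section \<open>Integrating out one block\<close>

text \<open>\<open>q\<close> is the common foot of the perpendiculars from the origin and from
  \<open>p\<close> to the hyperplane, \<open>a\<close> the signed distance of the origin and
  \<open>b\<close> the distance of \<open>p\<close>. Everything follows from Pythagoras,
  \<open>norm v ^ 2 = a ^ 2 + norm (v - q) ^ 2\<close> and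
  \<open>norm (p - v) ^ 2 = b ^ 2 + norm (v - q) ^ 2\<close>.\<close>

lemma plane_foot:
  fixes p v :: "'a::real_inner"
  assumes "0 < Q" and eq: "Q + norm v ^ 2 = norm (p - v) ^ 2"
  defines "a \<equiv> (norm p ^ 2 - Q) / (2 * norm p)" and "b \<equiv> (norm p ^ 2 + Q) / (2 * norm p)"
  defines "q \<equiv> (a / norm p) *\<^sub>R p"
  shows "p \<noteq> 0" "\<bar>a\<bar> \<le> norm v" "norm (v - q) \<le> norm v" "b \<le> norm (p - v)"
    "norm (v - q) \<le> norm (p - v)"
proof -
  show p: "p \<noteq> 0" using assms by auto
  have "2 * (v \<bullet> p) = norm p ^ 2 - Q"
    using eq by (simp add: power2_norm_eq_inner inner_simps inner_commute)
  then have vp: "v \<bullet> p = a * norm p"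
    using p by (simp add: a_def)
  have "norm (v - q) ^ 2 = norm v ^ 2 - 2 * (a / norm p) * (v \<bullet> p) + (a / norm p) ^ 2 * norm p ^ 2"
  proof -
    have "norm (v - q) ^ 2 = norm v ^ 2 - 2 * (v \<bullet> q) + norm q ^ 2"
      by (simp add: power2_norm_eq_inner inner_simps inner_commute)
    moreover have "norm q ^ 2 = (a / norm p) ^ 2 * norm p ^ 2"
      by (simp add: q_def power_mult_distrib[symmetric])
    ultimately show ?thesis by (simp add: q_def)
  qed
  also have "\<dots> = norm v ^ 2 - a ^ 2"
    using p by (simp add: vp power_divide) (simp add: power2_eq_square)
  finally have v: "norm v ^ 2 = a ^ 2 + norm (v - q) ^ 2" by simp
  \<comment> \<open>Multiplying the two gives \<open>b ^ 2 - a ^ 2 = Q\<close>, which matches the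
    constraint \<open>eq\<close>.\<close>
  have "b - a = Q / norm p" "b + a = norm p"
    using p by (simp_all add: a_def b_def field_simps power2_eq_square)
  then have "(b - a) * (b + a) = Q" using p by simp
  then have b: "b ^ 2 = a ^ 2 + Q" by (simp add: power2_eq_square algebra_simps)
  have pv: "norm (p - v) ^ 2 = b ^ 2 + norm (v - q) ^ 2"
    using eq v b by simp
  show "\<bar>a\<bar> \<le> norm v" by (rule power2_le_imp_le) (simp_all add: v)
  show "norm (v - q) \<le> norm v" by (rule power2_le_imp_le) (simp_all add: v)
  show "b \<le> norm (p - v)" by (rule power2_le_imp_le) (simp_all add: pv)
  show "norm (v - q) \<le> norm (p - v)" by (rule power2_le_imp_le) (simp_all add: pv)
qed

text \<open>Coordinate \<open>i\<close> is left out because it is the one solved for. Of the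
  exponent \<open>n - 1\<close> of \<open>weight v\<close>, a part \<open>\<epsilon>\<close> is
  spent on the distance \<open>a\<close>, and the rest is spread over \<open>n - 1\<close>
  coordinates, leaving each just below 1 and hence integrable. The weight of \<open>p - v\<close>
  supplies one further order of decay per coordinate, cut off at \<open>b\<close>.\<close>

lemma weights_on_plane_le:
  fixes p v :: "real ^ 'n"
  assumes n: "2 \<le> CARD('n)" and Q: "0 < Q" and eq: "Q + norm v ^ 2 = norm (p - v) ^ 2"
    and \<epsilon>: "0 < \<epsilon>" "\<epsilon> < 1"
  defines "a \<equiv> (norm p ^ 2 - Q) / (2 * norm p)" and "b \<equiv> (norm p ^ 2 + Q) / (2 * norm p)"
  defines "q \<equiv> (a / norm p) *\<^sub>R p"
  shows "weight v * weight (p - v) \<le> neg_powr \<epsilon> a *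
    (\<Prod>l\<in>UNIV - {i}. pole (1 - \<epsilon> / real (CARD('n) - 1)) 1 b (v $ l - q $ l))"
proof -
  let ?I = "UNIV - {i}" and ?d = "CARD('n) - 1"
  define \<epsilon>' where "\<epsilon>' = \<epsilon> / real ?d"
  have card: "card ?I = ?d"
    by (simp add: card_Diff_singleton)
  have "?I \<noteq> {}"
  proof
    assume "?I = {}"
    then have "card ?I = 0" by (simp only: card.empty)
    with card n show False by simp
  qed
  with card have I: "finite ?I" "?I \<noteq> {}" "card ?I = ?d"
    by simp_all
  have \<epsilon>': "real ?d * (1 - \<epsilon>') = real ?d - \<epsilon>" "0 \<le> 1 - \<epsilon>'"
    using n \<epsilon> by (simp_all add: \<epsilon>'_def field_simps)
  note foot = plane_foot[OF Q eq, folded a_def b_def, folded q_def]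
  have b: "0 \<le> b" using Q by (simp add: b_def)
  have comp: "\<bar>v $ l - q $ l\<bar> \<le> norm (v - q)" for l
    using component_le_norm_cart[of "v - q" l] by simp
  have "weight v = neg_powr \<epsilon> (norm v) * neg_powr (real (card ?I) * (1 - \<epsilon>')) (norm v)"
    using n I \<epsilon>' by (simp add: weight_eq_neg_powr neg_powr_add[symmetric])
  also have "\<dots> \<le> neg_powr \<epsilon> a * (\<Prod>l\<in>?I. neg_powr (1 - \<epsilon>') (v $ l - q $ l))"
    using foot I \<epsilon> \<epsilon>' comp
    by (intro mult_mono neg_powr_antimono neg_powr_le_prod) (auto intro: order_trans)
  finally have 1: "weight v \<le> neg_powr \<epsilon> a * (\<Prod>l\<in>?I. neg_powr (1 - \<epsilon>') (v $ l - q $ l))" .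
  have "weight (p - v) = neg_powr (real (card ?I) * 1) (norm (p - v))"
    using n I by (simp add: weight_eq_neg_powr)
  also have "\<dots> \<le> (\<Prod>l\<in>?I. neg_powr 1 (max b \<bar>v $ l - q $ l\<bar>))"
    using foot I comp b by (intro neg_powr_le_prod) (auto intro: order_trans)
  finally have 2: "weight (p - v) \<le> (\<Prod>l\<in>?I. neg_powr 1 (max b \<bar>v $ l - q $ l\<bar>))" .
  show ?thesis
    using mult_mono[OF 1 2] by (simp add: pole_def prod.distrib \<epsilon>'_def mult.assoc)
qed

text \<open>Here \<open>d = n - 1\<close>. The first power collects one integral of
  \<open>pole (1 - \<epsilon> / d) 1 b\<close> per coordinate of the hyperplane; the power of 2
  comes from bounding \<open>norm p\<close> by \<open>sqrt (norm p ^ 2 + Q)\<close>.\<close>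

definition plane_const :: "nat \<Rightarrow> real \<Rightarrow> real" where
  "plane_const d \<epsilon> = (2 / (\<epsilon> / d) + 2 / (1 - \<epsilon> / d)) ^ d * 2 ^ (d - 1)"

text \<open>\<open>v z\<close> stands for \<open>z\<close> moved along axis \<open>i\<close> onto
  the hyperplane. The majorant is a product over coordinates, in which the slab contributes 1 and
  each other coordinate a translated pole.\<close>

lemma nn_integral_plane_le:
  fixes p :: "real ^ 'n" and v :: "real ^ 'n \<Rightarrow> real ^ 'n"
  assumes n: "2 \<le> CARD('n)" and Q: "0 < Q" and eq: "\<And>z. Q + norm (v z) ^ 2 = norm (p - v z) ^ 2"
    and v: "\<And>z l. l \<noteq> i \<Longrightarrow> v z $ l = z $ l"
    and \<epsilon>: "0 < \<epsilon>" "\<epsilon> < 1"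
  shows "(\<integral>\<^sup>+z. indicator {0..1} (z $ i) * (weight (v z) * weight (p - v z) / ennreal (2 * norm p)) \<partial>lborel)
    \<le> ennreal (plane_const (CARD('n) - 1) \<epsilon>) *
      (neg_powr \<epsilon> (norm p ^ 2 - Q) * neg_powr (CARD('n) / 2 - \<epsilon>) (norm p ^ 2 + Q))"
proof -
  let ?I = "UNIV - {i}"
  define d where "d = CARD('n) - 1"
  define \<epsilon>' where "\<epsilon>' = \<epsilon> / real d"
  define K where "K = 2 / \<epsilon>' + 2 / (1 - \<epsilon>')"
  have d: "1 \<le> d" "CARD('n) = d + 1" "card ?I = d"
    using n by (auto simp: d_def card_Diff_singleton)
  have \<epsilon>': "0 < \<epsilon>'" "\<epsilon>' < 1" "real d * (1 - \<epsilon>') = real d - \<epsilon>"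
    using d \<epsilon> by (simp_all add: \<epsilon>'_def field_simps)
  have K: "0 \<le> K" using \<epsilon>' by (simp add: K_def)
  define a b where "a = (norm p ^ 2 - Q) / (2 * norm p)" and "b = (norm p ^ 2 + Q) / (2 * norm p)"
  define q where "q = (a / norm p) *\<^sub>R p"
  have p: "p \<noteq> 0" using plane_foot(1)[OF Q eq] .
  have b: "0 < b" using p Q by (simp add: b_def add_pos_pos)
  define f where "f l s = (if l = i then indicator {0..1} s else pole (1 - \<epsilon>') 1 b (s - q $ l))" for l s
  have [measurable]: "f l \<in> borel_measurable borel" for l
    unfolding f_def by measurable
  define r where "r = 1 / ennreal (2 * norm p)"
  have "(\<integral>\<^sup>+z. indicator {0..1} (z $ i) * (weight (v z) * weight (p - v z) / ennreal (2 * norm p)) \<partial>lborel)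
      \<le> (\<integral>\<^sup>+z. (neg_powr \<epsilon> a * r) * (\<Prod>l\<in>UNIV. f l (z $ l)) \<partial>lborel)"
  proof (rule nn_integral_mono)
    fix z :: "real ^ 'n"
    have "weight (v z) * weight (p - v z) \<le> neg_powr \<epsilon> a * (\<Prod>l\<in>?I. pole (1 - \<epsilon>') 1 b (v z $ l - q $ l))"
      unfolding \<epsilon>'_def d_def a_def b_def q_def by (rule weights_on_plane_le) (use assms in auto)
    also have "(\<Prod>l\<in>?I. pole (1 - \<epsilon>') 1 b (v z $ l - q $ l)) = (\<Prod>l\<in>?I. f l (z $ l))"
      by (intro prod.cong refl) (auto simp: f_def v)
    finally have "indicator {0..1} (z $ i) * (weight (v z) * weight (p - v z) / ennreal (2 * norm p))
        \<le> indicator {0..1} (z $ i) * (neg_powr \<epsilon> a * (\<Prod>l\<in>?I. f l (z $ l)) / ennreal (2 * norm p))"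
      by (intro mult_left_mono divide_right_mono_ennreal) auto
    also have "\<dots> = (neg_powr \<epsilon> a * r) * (f i (z $ i) * (\<Prod>l\<in>?I. f l (z $ l)))"
      by (simp add: f_def r_def divide_ennreal_def ac_simps)
    also have "f i (z $ i) * (\<Prod>l\<in>?I. f l (z $ l)) = (\<Prod>l\<in>UNIV. f l (z $ l))"
      by (rule prod.remove[symmetric]) auto
    finally show "indicator {0..1} (z $ i) * (weight (v z) * weight (p - v z) / ennreal (2 * norm p))
        \<le> (neg_powr \<epsilon> a * r) * (\<Prod>l\<in>UNIV. f l (z $ l))" .
  qed
  also have "\<dots> = (neg_powr \<epsilon> a * r) * (\<integral>\<^sup>+z. (\<Prod>l\<in>UNIV. f l (z $ l)) \<partial>lborel)"
    by (rule nn_integral_cmult) measurable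
  also have "(\<integral>\<^sup>+z. (\<Prod>l\<in>UNIV. f l (z $ l)) \<partial>lborel) = (\<Prod>l\<in>UNIV. \<integral>\<^sup>+s. f l s \<partial>lborel)"
    by (rule nn_integral_vec_prod) measurable
  also have "\<dots> = (\<integral>\<^sup>+s. f i s \<partial>lborel) * (\<Prod>l\<in>?I. \<integral>\<^sup>+s. f l s \<partial>lborel)"
    by (rule prod.remove) auto
  also have "(\<integral>\<^sup>+s. f i s \<partial>lborel) = 1"
    by (simp add: f_def)
  also have "(\<Prod>l\<in>?I. \<integral>\<^sup>+s. f l s \<partial>lborel) \<le> (\<Prod>l\<in>?I. ennreal K * neg_powr (1 - \<epsilon>') b)"
  proof (rule prod_mono_ennreal)
    fix l assume "l \<in> ?I"
    then have "(\<integral>\<^sup>+s. f l s \<partial>lborel) = (\<integral>\<^sup>+s. pole (1 - \<epsilon>') 1 b s \<partial>lborel)"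
      by (simp add: f_def nn_integral_shift)
    also have "\<dots> \<le> ennreal K * neg_powr (1 - \<epsilon>') b"
      using nn_integral_pole_le[of b "1 - \<epsilon>'" 1] b \<epsilon>' by (simp add: K_def)
    finally show "(\<integral>\<^sup>+s. f l s \<partial>lborel) \<le> ennreal K * neg_powr (1 - \<epsilon>') b" .
  qed
  also have "(\<Prod>l\<in>?I. ennreal K * neg_powr (1 - \<epsilon>') b) = ennreal (K ^ d) * neg_powr (real d - \<epsilon>) b"
    using d K by (simp add: power_mult_distrib ennreal_power neg_powr_power flip: \<epsilon>'(3))
  finally have "(\<integral>\<^sup>+z. indicator {0..1} (z $ i) * (weight (v z) * weight (p - v z) / ennreal (2 * norm p)) \<partial>lborel)
      \<le> neg_powr \<epsilon> a * r * (ennreal (K ^ d) * neg_powr (real d - \<epsilon>) b)"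
    by (simp add: mult_left_mono)
  also have "\<dots> \<le> ennreal (plane_const (CARD('n) - 1) \<epsilon>) *
      (neg_powr \<epsilon> (norm p ^ 2 - Q) * neg_powr (CARD('n) / 2 - \<epsilon>) (norm p ^ 2 + Q))"
  proof -
    \<comment> \<open>In these terms \<open>a = A / t\<close> and \<open>b = D / t\<close>, so the
      bound is \<open>A\<close> to the power \<open>-\<epsilon>\<close> times \<open>D\<close> to
      the power \<open>\<epsilon> - d\<close> times \<open>t\<close> to the power
      \<open>d - 1\<close>. The surplus power of \<open>t\<close> is absorbed through
      \<open>t \<le> 2 * sqrt D\<close>.\<close>
    define A D t where "A = norm p ^ 2 - Q" and "D = norm p ^ 2 + Q" and "t = 2 * norm p"
    have D: "0 < D" using Q by (simp add: D_def add_nonneg_pos)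
    have t: "0 < t" using p by (simp add: t_def)
    have "t ^ 2 \<le> 4 * D" using Q by (simp add: t_def D_def power_mult_distrib)
    then have "t \<le> sqrt (4 * D)" by (rule real_le_rsqrt)
    then have tD: "t \<le> 2 * sqrt D" by (simp add: real_sqrt_mult)
    have "t powr (real d - 1) \<le> (2 * sqrt D) powr (real d - 1)"
      using t tD d by (intro powr_mono2) auto
    also have "\<dots> = 2 ^ (d - 1) * D powr ((real d - 1) / 2)"
      using D d by (simp add: powr_mult powr_half_sqrt[symmetric] powr_powr powr_realpow[symmetric] of_nat_diff)
    finally have t_le: "t powr (real d - 1) \<le> 2 ^ (d - 1) * D powr ((real d - 1) / 2)" .
    have "neg_powr \<epsilon> a * r * (ennreal (K ^ d) * neg_powr (real d - \<epsilon>) b)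
        = neg_powr \<epsilon> A * ennreal (t powr \<epsilon>) * ennreal (1 / t) * ennreal (K ^ d) *
          ennreal (D powr - (real d - \<epsilon>) * t powr (real d - \<epsilon>))"
    proof -
      have inv: "neg_powr \<gamma> (1 / t) = ennreal (t powr \<gamma>)" for \<gamma>
        using t by (simp add: neg_powr_eq powr_minus powr_divide)
      have "a = A * (1 / t)" by (simp add: a_def A_def t_def)
      then have 1: "neg_powr \<epsilon> a = neg_powr \<epsilon> A * ennreal (t powr \<epsilon>)"
        by (simp only: neg_powr_mult inv)
      have "b = D * (1 / t)" by (simp add: b_def D_def t_def)
      then have 2: "neg_powr (real d - \<epsilon>) b = ennreal (D powr - (real d - \<epsilon>) * t powr (real d - \<epsilon>))"
        using D by (simp only: neg_powr_mult inv) (simp add: neg_powr_eq ennreal_mult[symmetric])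
      have "r = ennreal (1 / t)"
        using t unfolding r_def by (simp add: divide_ennreal[symmetric] flip: t_def)
      with 1 2 show ?thesis by (simp add: mult.assoc)
    qed
    also have "\<dots> = neg_powr \<epsilon> A * ennreal (K ^ d * (t powr (real d - 1) * D powr - (real d - \<epsilon>)))"
    proof -
      have "t powr \<epsilon> * (1 / t) * K ^ d * (D powr - (real d - \<epsilon>) * t powr (real d - \<epsilon>))
          = K ^ d * (t powr (\<epsilon> + (-1) + (real d - \<epsilon>)) * D powr - (real d - \<epsilon>))"
        unfolding powr_add using t by (simp add: powr_minus field_simps)
      then show ?thesis
        using t K D by (simp add: ennreal_mult[symmetric] mult.assoc)
    qed
    also have "\<dots> \<le> neg_powr \<epsilon> A * ennreal (K ^ d * (2 ^ (d - 1) * D powr ((real d - 1) / 2) * D powr - (real d - \<epsilon>)))"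
      using t_le K by (intro mult_left_mono ennreal_leI mult_right_mono) auto
    also have "K ^ d * (2 ^ (d - 1) * D powr ((real d - 1) / 2) * D powr - (real d - \<epsilon>))
        = plane_const (CARD('n) - 1) \<epsilon> * D powr - (CARD('n) / 2 - \<epsilon>)"
    proof -
      have "D powr ((real d - 1) / 2) * D powr - (real d - \<epsilon>) = D powr - (CARD('n) / 2 - \<epsilon>)"
      proof -
        have "(real d - 1) / 2 + - (real d - \<epsilon>) = - (CARD('n) / 2 - \<epsilon>)"
          unfolding d(2) by (simp add: field_simps)
        then show ?thesis by (simp only: powr_add[symmetric])
      qed
      moreover have "plane_const (CARD('n) - 1) \<epsilon> = K ^ d * 2 ^ (d - 1)"
        by (simp add: plane_const_def K_def \<epsilon>'_def d_def)
      ultimately show ?thesis by (simp add: mult.assoc)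
    qed
    also have "neg_powr \<epsilon> A * ennreal (plane_const (CARD('n) - 1) \<epsilon> * D powr - (CARD('n) / 2 - \<epsilon>))
        = ennreal (plane_const (CARD('n) - 1) \<epsilon>) * (neg_powr \<epsilon> A * neg_powr (CARD('n) / 2 - \<epsilon>) D)"
      using D by (simp add: neg_powr_eq ennreal_mult'' ac_simps)
    finally show ?thesis by (simp add: A_def D_def)
  qed
  finally show ?thesis .
qed

lemma inverse_ennreal_antimono:
  assumes "0 \<le> s" "s \<le> r"
  shows "inverse (ennreal r) \<le> inverse (ennreal s)"
  using assms by (cases "s = 0") (auto simp: inverse_ennreal intro!: ennreal_leI le_imp_inverse_le)

lemma sum_vec_lambda_upd:
  fixes x :: "'m::finite \<Rightarrow> 'a::comm_monoid_add"
  shows "(\<Sum>j\<in>UNIV. vec_lambda (x(k := y)) $ j) = y + (\<Sum>j\<in>UNIV - {k}. x j)"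
  by (subst sum.remove[of _ k]) auto

lemma quadric_block:
  fixes x :: "'m::finite \<Rightarrow> real ^ 'n" and w y :: "real ^ 'n" and k :: 'm
  defines "p \<equiv> w - (\<Sum>j\<in>UNIV - {k}. x j)" and "Q \<equiv> 1 + (\<Sum>j\<in>UNIV - {k}. norm (x j) ^ 2)"
  defines "X \<equiv> vec_lambda (x(k := y)) :: real ^ 'n ^ 'm"
  shows "quadric w X = Q + norm y ^ 2 - norm (p - y) ^ 2"
    and "quadric_grad w X $ k = 2 *\<^sub>R p"
    and "quadric_weight w X = (\<Prod>j\<in>UNIV - {k}. weight (x j)) * (weight y * weight (p - y))"
proof -
  have s: "w - (\<Sum>j\<in>UNIV. X $ j) = p - y"
    unfolding X_def sum_vec_lambda_upd p_def by simp
  have "(\<Sum>j\<in>UNIV. norm (X $ j) ^ 2) = norm y ^ 2 + (\<Sum>j\<in>UNIV - {k}. norm (x j) ^ 2)"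
    unfolding X_def by (subst sum.remove[of _ k]) auto
  then show "quadric w X = Q + norm y ^ 2 - norm (p - y) ^ 2"
    by (simp add: quadric_def s Q_def)
  show "quadric_grad w X $ k = 2 *\<^sub>R p"
    unfolding quadric_grad_def s by (simp add: X_def)
  have "(\<Prod>j\<in>UNIV. weight (X $ j)) = weight y * (\<Prod>j\<in>UNIV - {k}. weight (x j))"
    unfolding X_def by (subst prod.remove[of _ k]) auto
  then show "quadric_weight w X = (\<Prod>j\<in>UNIV - {k}. weight (x j)) * (weight y * weight (p - y))"
    by (simp add: quadric_weight_def s ac_simps)
qed

text \<open>The Newton step alters only coordinate \<open>i\<close> of block \<open>k\<close> and
  lands on the hyperplane, so the estimate on the hyperplane applies with the other blocks frozen.
  If \<open>p $ i = 0\<close> the slope vanishes and the integrand is 0 by its case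
  distinction.\<close>

lemma nn_integral_block_le:
  fixes x :: "'m::finite \<Rightarrow> real ^ 'n" and w :: "real ^ 'n" and k :: 'm and i :: 'n
  assumes n: "2 \<le> CARD('n)" and \<epsilon>: "0 < \<epsilon>" "\<epsilon> < 1"
  defines "e \<equiv> axis k (axis i 1) :: real ^ 'n ^ 'm"
  defines "\<Psi> \<equiv> \<lambda>X. X - (quadric w X / (quadric_grad w X \<bullet> e)) *\<^sub>R e"
  defines "p \<equiv> w - (\<Sum>j\<in>UNIV - {k}. x j)" and "Q \<equiv> 1 + (\<Sum>j\<in>UNIV - {k}. norm (x j) ^ 2)"
  defines "X \<equiv> \<lambda>z. vec_lambda (x(k := z)) :: real ^ 'n ^ 'm"
  shows "(\<integral>\<^sup>+z. indicator {0..1} (X z \<bullet> e) * (if quadric_grad w (X z) \<bullet> e = 0 then 0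
        else quadric_weight w (\<Psi> (X z)) / ennreal (norm (quadric_grad w (\<Psi> (X z))))) \<partial>lborel)
    \<le> (\<Prod>j\<in>UNIV - {k}. weight (x j)) * (ennreal (plane_const (CARD('n) - 1) \<epsilon>) *
      (neg_powr \<epsilon> (norm p ^ 2 - Q) * neg_powr (CARD('n) / 2 - \<epsilon>) (norm p ^ 2 + Q)))"
proof (cases "p $ i = 0")
  case True
  then have "quadric_grad w (X z) \<bullet> e = 0" for z
    by (simp add: X_def e_def inner_axis quadric_block p_def)
  then show ?thesis by simp
next
  case False
  define v where "v z = z - ((Q + norm z ^ 2 - norm (p - z) ^ 2) / (2 * p $ i)) *\<^sub>R axis i 1" for z
  have grad: "quadric_grad w (X z) \<bullet> e = 2 * p $ i" for z
    by (simp add: X_def e_def inner_axis quadric_block p_def)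
  have axis: "c *\<^sub>R e = axis k (c *\<^sub>R axis i 1)" for c
    by (simp add: e_def axis_def vec_eq_iff)
  have \<Psi>: "\<Psi> (X z) = X (v z)" for z
    unfolding \<Psi>_def grad axis unfolding X_def quadric_block v_def p_def[symmetric] Q_def[symmetric]
    by (simp add: vec_eq_iff axis_def)
  have Q: "0 < Q" by (simp add: Q_def add_pos_nonneg sum_nonneg)
  have eq: "Q + norm (v z) ^ 2 = norm (p - v z) ^ 2" for z
  proof -
    define c where "c = (Q + norm z ^ 2 - norm (p - z) ^ 2) / (2 * p $ i)"
    have "Q + norm (v z) ^ 2 - norm (p - v z) ^ 2 = Q - p \<bullet> p + 2 * (p \<bullet> v z)"
      by (simp add: power2_norm_eq_inner inner_simps inner_commute)
    also have "p \<bullet> v z = p \<bullet> z - c * p $ i"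
      by (simp add: v_def c_def inner_simps inner_axis)
    also have "2 * (p \<bullet> z - c * p $ i) = 2 * (p \<bullet> z) - (Q + norm z ^ 2 - norm (p - z) ^ 2)"
    proof -
      have "2 * (c * p $ i) = Q + norm z ^ 2 - norm (p - z) ^ 2"
        using False by (simp add: c_def)
      then show ?thesis by (simp add: right_diff_distrib)
    qed
    also have "Q - p \<bullet> p + \<dots> = 0"
      by (simp add: power2_norm_eq_inner inner_simps inner_commute)
    finally show ?thesis by simp
  qed
  have "(\<integral>\<^sup>+z. indicator {0..1} (X z \<bullet> e) * (if quadric_grad w (X z) \<bullet> e = 0 then 0
        else quadric_weight w (\<Psi> (X z)) / ennreal (norm (quadric_grad w (\<Psi> (X z))))) \<partial>lborel)
    \<le> (\<integral>\<^sup>+z. (\<Prod>j\<in>UNIV - {k}. weight (x j)) *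
        (indicator {0..1} (z $ i) * (weight (v z) * weight (p - v z) / ennreal (2 * norm p))) \<partial>lborel)"
  proof (rule nn_integral_mono)
    fix z
    \<comment> \<open>The gradient is at least as long as its block \<open>k\<close>, which is
      \<open>2 *\<^sub>R p\<close> and does not depend on \<open>z\<close>.\<close>
    have "norm (2 *\<^sub>R p) \<le> norm (quadric_grad w (X (v z)))"
      using Finite_Cartesian_Product.norm_nth_le[of "quadric_grad w (X (v z))" k] by (simp add: X_def quadric_block p_def)
    then have "quadric_weight w (X (v z)) / ennreal (norm (quadric_grad w (X (v z))))
        \<le> quadric_weight w (X (v z)) / ennreal (2 * norm p)"
      unfolding divide_ennreal_def by (intro mult_left_mono inverse_ennreal_antimono) auto
    then have "indicator {0..1} (z $ i) * (quadric_weight w (X (v z)) / ennreal (norm (quadric_grad w (X (v z)))))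
        \<le> indicator {0..1} (z $ i) * (quadric_weight w (X (v z)) / ennreal (2 * norm p))"
      by (rule mult_left_mono) simp
    moreover have qw: "quadric_weight w (X (v z)) = (\<Prod>j\<in>UNIV - {k}. weight (x j)) * (weight (v z) * weight (p - v z))"
      by (simp add: X_def quadric_block p_def)
    ultimately show "indicator {0..1} (X z \<bullet> e) * (if quadric_grad w (X z) \<bullet> e = 0 then 0
        else quadric_weight w (\<Psi> (X z)) / ennreal (norm (quadric_grad w (\<Psi> (X z)))))
      \<le> (\<Prod>j\<in>UNIV - {k}. weight (x j)) *
        (indicator {0..1} (z $ i) * (weight (v z) * weight (p - v z) / ennreal (2 * norm p)))"
      using False by (simp add: grad \<Psi> qw) (simp add: X_def e_def inner_axis divide_ennreal_def ac_simps)
  qed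
  also have "\<dots> = (\<Prod>j\<in>UNIV - {k}. weight (x j)) *
      (\<integral>\<^sup>+z. indicator {0..1} (z $ i) * (weight (v z) * weight (p - v z) / ennreal (2 * norm p)) \<partial>lborel)"
    by (rule nn_integral_cmult) (simp add: v_def weight_def)
  also have "\<dots> \<le> (\<Prod>j\<in>UNIV - {k}. weight (x j)) * (ennreal (plane_const (CARD('n) - 1) \<epsilon>) *
      (neg_powr \<epsilon> (norm p ^ 2 - Q) * neg_powr (CARD('n) / 2 - \<epsilon>) (norm p ^ 2 + Q)))"
    using n Q eq \<epsilon> by (intro mult_left_mono nn_integral_plane_le) (auto simp: v_def axis_def)
  finally show ?thesis .
qed

section \<open>The remaining blocks\<close>

context pole_exponents
begin

text \<open>\<open>s = sqrt (norm p ^ 2 + Q)\<close> bounds 1, \<open>norm p\<close> and all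
  \<open>norm (x j)\<close>, hence by the triangle inequality \<open>(CARD('m) + 1) * s\<close>
  bounds \<open>W\<close>. Its exponent \<open>n - 2 * \<epsilon>\<close> is spread over all
  \<open>(m - 1) * n\<close> coordinates, \<open>\<beta>\<close> for each; each weight is spread
  over \<open>n\<close> coordinates, \<open>\<gamma> = (n - 1) / n\<close> for each.\<close>

lemma outer_weights_le:
  fixes x :: "'m::finite \<Rightarrow> real ^ 'n" and w :: "real ^ 'n" and k :: 'm
  assumes n: "2 \<le> CARD('n)" and m: "2 \<le> CARD('m)"
    and \<gamma>: "\<gamma> = 1 - 1 / CARD('n)"
    and \<beta>: "\<beta> = (CARD('n) - 2 * \<epsilon>) / ((CARD('m) - 1) * CARD('n))"
    and W: "W = sqrt (1 + norm w ^ 2)"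
  defines "p \<equiv> w - (\<Sum>j\<in>UNIV - {k}. x j)" and "Q \<equiv> 1 + (\<Sum>j\<in>UNIV - {k}. norm (x j) ^ 2)"
  shows "(\<Prod>j\<in>UNIV - {k}. weight (x j)) * neg_powr (CARD('n) / 2 - \<epsilon>) (norm p ^ 2 + Q)
    \<le> ennreal ((CARD('m) + 1) powr (CARD('n) - 2 * \<epsilon>)) * (\<Prod>j\<in>UNIV - {k}. vpole (x j))"
proof -
  let ?I = "UNIV - {k}" and ?n = "real CARD('n)" and ?m = "real CARD('m)"
  have I: "card ?I = CARD('m) - 1" by (simp add: card_Diff_singleton)
  define s where "s = sqrt (norm p ^ 2 + Q)"
  define R where "R = (?m + 1) * s"
  have sum: "0 \<le> (\<Sum>j\<in>?I. norm (x j) ^ 2)" by (simp add: sum_nonneg)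
  have s: "1 \<le> s" and p: "norm p \<le> s"
    using sum by (auto simp: s_def Q_def intro!: real_le_rsqrt)
  have xj: "norm (x j) \<le> s" if "j \<in> ?I" for j
  proof -
    have "norm (x j) ^ 2 \<le> (\<Sum>j\<in>?I. norm (x j) ^ 2)"
      using that by (intro member_le_sum) auto
    then show ?thesis by (auto simp: s_def Q_def intro!: real_le_rsqrt add_increasing)
  qed
  have "norm w \<le> norm p + norm (\<Sum>j\<in>?I. x j)"
    using norm_triangle_ineq[of p "\<Sum>j\<in>?I. x j"] by (simp add: p_def)
  also have "\<dots> \<le> s + (\<Sum>j\<in>?I. s)"
    using p xj by (intro add_mono sum_norm_le) auto
  also have "\<dots> = ?m * s"
    using m by (simp add: I of_nat_diff algebra_simps)
  finally have w: "norm w \<le> ?m * s" .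
  have "W \<le> 1 + norm w"
    unfolding W by (rule real_le_lsqrt) (auto simp: power2_eq_square algebra_simps)
  with w s have WR: "W \<le> R" by (simp add: R_def algebra_simps)
  have sR: "s \<le> R" using s by (simp add: R_def algebra_simps)
  have "neg_powr (?n / 2 - \<epsilon>) (norm p ^ 2 + Q) = neg_powr (?n / 2 - \<epsilon>) (s * s)"
    using sum by (simp add: s_def Q_def add_nonneg_nonneg)
  also have "\<dots> = neg_powr (?n - 2 * \<epsilon>) s"
    unfolding neg_powr_mult neg_powr_add[symmetric] by (simp add: algebra_simps)
  also have "\<dots> = ennreal ((?m + 1) powr (?n - 2 * \<epsilon>)) * neg_powr (?n - 2 * \<epsilon>) R"
  proof -
    have "ennreal ((?m + 1) powr (?n - 2 * \<epsilon>)) * neg_powr (?n - 2 * \<epsilon>) (?m + 1) = 1"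
      by (simp add: neg_powr_eq ennreal_mult[symmetric] powr_add[symmetric])
    then show ?thesis
      unfolding R_def neg_powr_mult by (simp add: mult.assoc[symmetric])
  qed
  also have "neg_powr (?n - 2 * \<epsilon>) R = neg_powr (card (?I \<times> (UNIV :: 'n set)) * \<beta>) R"
    using m by (simp add: I \<beta> card_cartesian_product of_nat_diff)
  also have "\<dots> \<le> (\<Prod>jl\<in>?I \<times> (UNIV :: 'n set). neg_powr \<beta> (max W \<bar>x (fst jl) $ snd jl\<bar>))"
  proof (rule neg_powr_le_prod)
    have "?I \<noteq> {}"
    proof
      assume "?I = {}"
      then have "card ?I = 0" by (simp only: card.empty)
      with I m show False by simp
    qed
    then show "?I \<times> (UNIV :: 'n set) \<noteq> {}" by auto
    fix jl assume "jl \<in> ?I \<times> (UNIV :: 'n set)"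
    then have "fst jl \<in> ?I" by auto
    then have "\<bar>x (fst jl) $ snd jl\<bar> \<le> s"
      using xj component_le_norm_cart[of "x (fst jl)" "snd jl"] by (blast intro: order_trans)
    then show "\<bar>max W \<bar>x (fst jl) $ snd jl\<bar>\<bar> \<le> \<bar>R\<bar>"
      using WR sR by auto
  qed (use exps in auto)
  also have "\<dots> = (\<Prod>j\<in>?I. \<Prod>l\<in>UNIV. neg_powr \<beta> (max W \<bar>x j $ l\<bar>))"
    by (simp add: prod.cartesian_product split_def)
  finally have 1: "neg_powr (?n / 2 - \<epsilon>) (norm p ^ 2 + Q) \<le> ennreal ((?m + 1) powr (?n - 2 * \<epsilon>)) *
      (\<Prod>j\<in>?I. \<Prod>l\<in>UNIV. neg_powr \<beta> (max W \<bar>x j $ l\<bar>))"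
    by (simp add: mult_left_mono)
  have "weight (x j) \<le> (\<Prod>l\<in>UNIV. neg_powr \<gamma> (x j $ l))" for j
  proof -
    have "weight (x j) = neg_powr (card (UNIV :: 'n set) * \<gamma>) (norm (x j))"
      using n by (simp add: weight_eq_neg_powr \<gamma> right_diff_distrib of_nat_diff)
    also have "\<dots> \<le> (\<Prod>l\<in>UNIV. neg_powr \<gamma> (x j $ l))"
      using exps by (intro neg_powr_le_prod) (auto simp: component_le_norm_cart)
    finally show ?thesis .
  qed
  then have 2: "(\<Prod>j\<in>?I. weight (x j)) \<le> (\<Prod>j\<in>?I. \<Prod>l\<in>UNIV. neg_powr \<gamma> (x j $ l))"
    by (intro prod_mono_ennreal)
  show ?thesis
    using mult_mono[OF 2 1] by (simp add: vpole_def pole_def prod.distrib ac_simps)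
qed

text \<open>The remaining singular factor is integrated in a single block. Its norm is at least the
  absolute value of one coordinate, which is affine with slope of size 1 in that block; this yields
  \<open>neg_powr \<epsilon> W\<close>, at most \<open>neg_powr \<epsilon> (norm w)\<close>. With no
  block left, the factor already is \<open>neg_powr \<epsilon> (norm w)\<close>.\<close>

lemma nn_integral_vpoles_le:
  fixes w :: "real ^ 'n" and K :: "'m set"
  assumes K: "finite K" and w: "norm w \<le> W"
  shows "(\<integral>\<^sup>+x. (\<Prod>j\<in>K. vpole (x j)) * neg_powr \<epsilon> (norm (w - (\<Sum>j\<in>K. x j))) \<partial>(\<Pi>\<^sub>M j\<in>K. lborel))
    \<le> ennreal (CARD('n) powr \<epsilon>) * (pole_bound ^ CARD('n)) ^ card K * neg_powr \<epsilon> (norm w)"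
proof (cases "K = {}")
  case True
  have "1 \<le> ennreal (CARD('n) powr \<epsilon>)"
    using exps by (simp add: ge_one_powr_ge_zero)
  then have "1 * neg_powr \<epsilon> (norm w) \<le> ennreal (CARD('n) powr \<epsilon>) * neg_powr \<epsilon> (norm w)"
    by (rule mult_right_mono) simp
  then show ?thesis
    using True by (simp add: PiM_empty nn_integral_count_space_finite)
next
  case False
  then obtain k where k: "k \<in> K" by auto
  define L where "L = K - {k}"
  have L: "finite L" "k \<notin> L" "K = insert k L" "card K = Suc (card L)"
    using K k by (auto simp: L_def card_Suc_Diff1 insert_absorb simp del: card_Diff_insert)
  \<comment> \<open>Any fixed coordinate serves.\<close>
  define l :: 'n where "l = undefined"
  let ?P = "\<Pi>\<^sub>M j\<in>L. lborel :: (real ^ 'n) measure"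
  let ?B = "ennreal (CARD('n) powr \<epsilon>) * pole_bound ^ CARD('n) * neg_powr \<epsilon> (norm w)"
  have "(\<integral>\<^sup>+x. (\<Prod>j\<in>K. vpole (x j)) * neg_powr \<epsilon> (norm (w - (\<Sum>j\<in>K. x j))) \<partial>(\<Pi>\<^sub>M j\<in>K. lborel))
      = (\<integral>\<^sup>+x. (\<integral>\<^sup>+y. (\<Prod>j\<in>K. vpole ((x(k := y)) j)) *
          neg_powr \<epsilon> (norm (w - (\<Sum>j\<in>K. (x(k := y)) j))) \<partial>lborel) \<partial>?P)"
    unfolding L(3)
    by (rule product_sigma_finite.product_nn_integral_insert[OF product_sigma_finite_lborel L(1,2)]) measurable
  also have "\<dots> \<le> (\<integral>\<^sup>+x. (\<Prod>j\<in>L. vpole (x j)) * ?B \<partial>?P)"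
  proof (rule nn_integral_mono)
    fix x :: "'m \<Rightarrow> real ^ 'n"
    define c where "c = w - (\<Sum>j\<in>L. x j)"
    have "(\<integral>\<^sup>+y. (\<Prod>j\<in>K. vpole ((x(k := y)) j)) * neg_powr \<epsilon> (norm (w - (\<Sum>j\<in>K. (x(k := y)) j))) \<partial>lborel)
        \<le> (\<integral>\<^sup>+y. (\<Prod>j\<in>L. vpole (x j)) * (vpole y * neg_powr \<epsilon> (c $ l + (- axis l 1) \<bullet> y)) \<partial>lborel)"
    proof (rule nn_integral_mono)
      fix y :: "real ^ 'n"
      have "(\<Prod>j\<in>K. vpole ((x(k := y)) j)) = vpole y * (\<Prod>j\<in>L. vpole (x j))"
      proof -
        have "(\<Prod>j\<in>L. vpole ((x(k := y)) j)) = (\<Prod>j\<in>L. vpole (x j))"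
          using L(2) by (intro prod.cong) auto
        then show ?thesis
          unfolding L(3) by (subst prod.insert[OF L(1,2)]) simp
      qed
      moreover have "w - (\<Sum>j\<in>K. (x(k := y)) j) = c - y"
      proof -
        have "(\<Sum>j\<in>L. (x(k := y)) j) = (\<Sum>j\<in>L. x j)"
          using L(2) by (intro sum.cong) auto
        then show ?thesis
          unfolding L(3) by (subst sum.insert[OF L(1,2)]) (simp add: c_def)
      qed
      moreover have "neg_powr \<epsilon> (norm (c - y)) \<le> neg_powr \<epsilon> (c $ l + (- axis l 1) \<bullet> y)"
        using component_le_norm_cart[of "c - y" l] exps
        by (intro neg_powr_antimono) (auto simp: inner_axis inner_commute)
      then have "vpole y * (\<Prod>j\<in>L. vpole (x j)) * neg_powr \<epsilon> (norm (c - y))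
          \<le> vpole y * (\<Prod>j\<in>L. vpole (x j)) * neg_powr \<epsilon> (c $ l + (- axis l 1) \<bullet> y)"
        by (rule mult_left_mono) simp
      ultimately show "(\<Prod>j\<in>K. vpole ((x(k := y)) j)) * neg_powr \<epsilon> (norm (w - (\<Sum>j\<in>K. (x(k := y)) j)))
          \<le> (\<Prod>j\<in>L. vpole (x j)) * (vpole y * neg_powr \<epsilon> (c $ l + (- axis l 1) \<bullet> y))"
        by (simp only: ac_simps)
    qed
    also have "\<dots> = (\<Prod>j\<in>L. vpole (x j)) * (\<integral>\<^sup>+y. vpole y * neg_powr \<epsilon> (c $ l + (- axis l 1) \<bullet> y) \<partial>lborel)"
      by (rule nn_integral_cmult) measurable
    also have "\<dots> \<le> (\<Prod>j\<in>L. vpole (x j)) *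
        (ennreal (CARD('n) powr \<epsilon>) * pole_bound ^ CARD('n) * neg_powr \<epsilon> W * neg_powr \<epsilon> (norm (- axis l 1 :: real ^ 'n)))"
      by (intro mult_left_mono nn_integral_vpole_singular_le) simp
    also have "\<dots> \<le> (\<Prod>j\<in>L. vpole (x j)) * ?B"
      using w exps by (auto intro!: mult_left_mono neg_powr_antimono)
    finally show "(\<integral>\<^sup>+y. (\<Prod>j\<in>K. vpole ((x(k := y)) j)) *
        neg_powr \<epsilon> (norm (w - (\<Sum>j\<in>K. (x(k := y)) j))) \<partial>lborel) \<le> (\<Prod>j\<in>L. vpole (x j)) * ?B" .
  qed
  also have "\<dots> = (\<integral>\<^sup>+x. (\<Prod>j\<in>L. vpole (x j)) \<partial>?P) * ?B"
    by (rule nn_integral_multc) measurable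
  also have "(\<integral>\<^sup>+x. (\<Prod>j\<in>L. vpole (x j)) \<partial>?P) = (\<Prod>j\<in>L. \<integral>\<^sup>+y. vpole (y :: real ^ 'n) \<partial>lborel)"
    using L(1) by (rule product_sigma_finite.product_nn_integral_prod[OF product_sigma_finite_lborel]) auto
  also have "\<dots> \<le> (\<Prod>j\<in>L. pole_bound ^ CARD('n))"
    by (intro prod_mono_ennreal nn_integral_vpole_le)
  finally show ?thesis
    unfolding L(4) by (simp add: ac_simps mult_left_mono mult_right_mono)
qed

end

context pole_exponents
begin

text \<open>The argument of the singular factor is affine in block \<open>k\<close>, because
  \<open>norm y ^ 2\<close> cancels, and its slope is -2 times \<open>w\<close> minus the sum of the
  blocks in \<open>K\<close>. Integrating block \<open>k\<close> thus reproduces a negative power of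
  that vector, the factor treated by \<open>nn_integral_vpoles_le\<close>.\<close>

lemma nn_integral_vpoles_affine_le:
  fixes w :: "real ^ 'n" and K :: "'m set"
  assumes K: "finite K" "k \<notin> K" and w: "norm w \<le> W"
  shows "(\<integral>\<^sup>+x. (\<Prod>j\<in>insert k K. vpole (x j)) * neg_powr \<epsilon>
        (norm (w - (\<Sum>j\<in>insert k K. x j)) ^ 2 - (1 + (\<Sum>j\<in>insert k K. norm (x j) ^ 2)))
      \<partial>(\<Pi>\<^sub>M j\<in>insert k K. lborel))
    \<le> ennreal (CARD('n) powr \<epsilon>) ^ 2 * (pole_bound ^ CARD('n)) ^ Suc (card K) * neg_powr \<epsilon> W * neg_powr \<epsilon> (norm w)"
proof -
  let ?P = "\<Pi>\<^sub>M j\<in>K. lborel :: (real ^ 'n) measure"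
  let ?L = "insert k K"
  let ?B = "ennreal (CARD('n) powr \<epsilon>) * pole_bound ^ CARD('n) * neg_powr \<epsilon> W"
  have "(\<integral>\<^sup>+x. (\<Prod>j\<in>?L. vpole (x j)) * neg_powr \<epsilon>
        (norm (w - (\<Sum>j\<in>?L. x j)) ^ 2 - (1 + (\<Sum>j\<in>?L. norm (x j) ^ 2))) \<partial>(\<Pi>\<^sub>M j\<in>?L. lborel))
      = (\<integral>\<^sup>+x. (\<integral>\<^sup>+y. (\<Prod>j\<in>?L. vpole ((x(k := y)) j)) * neg_powr \<epsilon>
          (norm (w - (\<Sum>j\<in>?L. (x(k := y)) j)) ^ 2 - (1 + (\<Sum>j\<in>?L. norm ((x(k := y)) j) ^ 2)))
          \<partial>lborel) \<partial>?P)"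
    by (rule product_sigma_finite.product_nn_integral_insert[OF product_sigma_finite_lborel K]) measurable
  also have "\<dots> \<le> (\<integral>\<^sup>+x. ?B * ((\<Prod>j\<in>K. vpole (x j)) * neg_powr \<epsilon> (norm (w - (\<Sum>j\<in>K. x j)))) \<partial>?P)"
  proof (rule nn_integral_mono)
    fix x :: "'m \<Rightarrow> real ^ 'n"
    define p where "p = w - (\<Sum>j\<in>K. x j)"
    define c where "c = norm p ^ 2 - (1 + (\<Sum>j\<in>K. norm (x j) ^ 2))"
    define v where "v = (- 2) *\<^sub>R p"
    have "(\<Prod>j\<in>?L. vpole ((x(k := y)) j)) * neg_powr \<epsilon>
          (norm (w - (\<Sum>j\<in>?L. (x(k := y)) j)) ^ 2 - (1 + (\<Sum>j\<in>?L. norm ((x(k := y)) j) ^ 2)))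
        = (\<Prod>j\<in>K. vpole (x j)) * (vpole y * neg_powr \<epsilon> (c + v \<bullet> y))" for y
    proof -
      have "(\<Prod>j\<in>K. vpole ((x(k := y)) j)) = (\<Prod>j\<in>K. vpole (x j))"
        using K(2) by (intro prod.cong) auto
      then have 1: "(\<Prod>j\<in>?L. vpole ((x(k := y)) j)) = vpole y * (\<Prod>j\<in>K. vpole (x j))"
        by (subst prod.insert[OF K]) simp
      have "(\<Sum>j\<in>K. (x(k := y)) j) = (\<Sum>j\<in>K. x j)"
        using K(2) by (intro sum.cong) auto
      then have 2: "w - (\<Sum>j\<in>?L. (x(k := y)) j) = p - y"
        by (subst sum.insert[OF K]) (simp add: p_def)
      have "(\<Sum>j\<in>K. norm ((x(k := y)) j) ^ 2) = (\<Sum>j\<in>K. norm (x j) ^ 2)"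
        using K(2) by (intro sum.cong) auto
      then have 3: "(\<Sum>j\<in>?L. norm ((x(k := y)) j) ^ 2) = norm y ^ 2 + (\<Sum>j\<in>K. norm (x j) ^ 2)"
        by (subst sum.insert[OF K]) simp
      have 4: "norm (p - y) ^ 2 - (1 + (norm y ^ 2 + (\<Sum>j\<in>K. norm (x j) ^ 2))) = c + v \<bullet> y"
        by (simp add: c_def v_def power2_norm_eq_inner inner_simps inner_commute)
      show ?thesis unfolding 1 2 3 4 by (simp only: ac_simps)
    qed
    then have "(\<integral>\<^sup>+y. (\<Prod>j\<in>?L. vpole ((x(k := y)) j)) * neg_powr \<epsilon>
          (norm (w - (\<Sum>j\<in>?L. (x(k := y)) j)) ^ 2 - (1 + (\<Sum>j\<in>?L. norm ((x(k := y)) j) ^ 2))) \<partial>lborel)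
        = (\<Prod>j\<in>K. vpole (x j)) * (\<integral>\<^sup>+y. vpole y * neg_powr \<epsilon> (c + v \<bullet> y) \<partial>lborel)"
      by (simp only:) (rule nn_integral_cmult, measurable)
    also have "\<dots> \<le> (\<Prod>j\<in>K. vpole (x j)) * (?B * neg_powr \<epsilon> (norm v))"
      by (intro mult_left_mono nn_integral_vpole_singular_le) simp
    also have "\<dots> \<le> (\<Prod>j\<in>K. vpole (x j)) * (?B * neg_powr \<epsilon> (norm p))"
      using exps by (intro mult_left_mono neg_powr_antimono) (auto simp: v_def)
    finally show "(\<integral>\<^sup>+y. (\<Prod>j\<in>?L. vpole ((x(k := y)) j)) * neg_powr \<epsilon>
          (norm (w - (\<Sum>j\<in>?L. (x(k := y)) j)) ^ 2 - (1 + (\<Sum>j\<in>?L. norm ((x(k := y)) j) ^ 2))) \<partial>lborel)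
        \<le> ?B * ((\<Prod>j\<in>K. vpole (x j)) * neg_powr \<epsilon> (norm (w - (\<Sum>j\<in>K. x j))))"
      by (simp only: p_def ac_simps)
  qed
  also have "\<dots> = ?B * (\<integral>\<^sup>+x. (\<Prod>j\<in>K. vpole (x j)) * neg_powr \<epsilon> (norm (w - (\<Sum>j\<in>K. x j))) \<partial>?P)"
    by (rule nn_integral_cmult) measurable
  also have "\<dots> \<le> ?B * (ennreal (CARD('n) powr \<epsilon>) * (pole_bound ^ CARD('n)) ^ card K * neg_powr \<epsilon> (norm w))"
    by (intro mult_left_mono nn_integral_vpoles_le K w) simp
  also have "\<dots> = ennreal (CARD('n) powr \<epsilon>) ^ 2 * (pole_bound ^ CARD('n)) ^ Suc (card K) * neg_powr \<epsilon> W * neg_powr \<epsilon> (norm w)"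
    by (simp add: power2_eq_square ac_simps)
  finally show ?thesis .
qed

end

section \<open>The bound on the delta integral, uniform in the vector w\<close>

lemma quadric_measurable [measurable]: "quadric w \<in> borel_measurable borel"
  unfolding quadric_def by measurable

lemma quadric_grad_measurable [measurable]: "quadric_grad w \<in> borel_measurable borel"
  unfolding quadric_grad_def
  by (rule measurable_compose[OF measurable_PiM_single' measurable_vec_lambda]) auto

lemma weight_measurable [measurable]: "weight \<in> borel_measurable borel"
  unfolding weight_def by measurable

lemma quadric_weight_measurable [measurable]: "quadric_weight w \<in> borel_measurable borel"
  unfolding quadric_weight_def by measurable

text \<open>The point is that the right side does not involve \<open>w\<close>. The value of
  \<open>\<epsilon>\<close> lies strictly between 0 and \<open>1 / n\<close>, so that
  \<open>\<gamma> + \<epsilon> < 1\<close>; \<open>\<gamma>\<close> and \<open>\<beta>\<close> are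
  those dictated by \<open>outer_weights_le\<close>.\<close>

lemma delta_integral_quadric_le:
  fixes w :: "real ^ 'n" and \<gamma> \<beta> \<epsilon> :: real
  assumes m: "2 \<le> CARD('m)" and n: "CARD('m) \<le> CARD('n)"
  defines "\<epsilon> \<equiv> 1 / (2 * real CARD('n))" and "\<gamma> \<equiv> 1 - 1 / real CARD('n)"
  defines "\<beta> \<equiv> (real CARD('n) - 2 * \<epsilon>) / ((real CARD('m) - 1) * real CARD('n))"
  shows "ennreal (norm w ^ (CARD('n) + 1 - CARD('m))) *
      delta_integral (quadric w :: real ^ 'n ^ 'm \<Rightarrow> real) (quadric_weight w)
    \<le> ennreal (2 * graph_const TYPE(real ^ 'n ^ 'm) (1 + DIM(real ^ 'n ^ 'm))) *
      (of_nat DIM(real ^ 'n ^ 'm) *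
       (ennreal (plane_const (CARD('n) - 1) \<epsilon>) * ennreal ((CARD('m) + 1) powr (CARD('n) - 2 * \<epsilon>)) *
        (ennreal (CARD('n) powr \<epsilon>) ^ 2 * ennreal (pole_const \<gamma> \<beta> \<epsilon>) ^ (CARD('n) * (CARD('m) - 1)))))"
    (is "?w * _ \<le> ?C0 * (_ * (?Cp * ?Co * (?Cn ^ 2 * ?CJ)))")
proof (cases "w = 0")
  case True
  \<comment> \<open>The exponent \<open>n + 1 - m\<close> is positive since
    \<open>m \<le> n\<close>, so the prefactor is 0 and the product vanishes even if the integral is
    infinite.\<close>
  then show ?thesis using n by (simp add: Suc_diff_le)
next
  case False
  let ?n = "real CARD('n)" and ?m = "real CARD('m)"
  define W where "W = sqrt (1 + norm w ^ 2)"
  have n2: "2 \<le> ?n" "2 \<le> ?m" "?m \<le> ?n" using m n by auto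
  have \<epsilon>: "0 < \<epsilon>" "\<epsilon> < 1 / ?n" "\<epsilon> < 1" "2 * \<epsilon> < 1"
    using n2 by (auto simp: \<epsilon>_def field_simps)
  \<comment> \<open>Equivalent to \<open>1 < \<gamma> + \<beta>\<close>; this is where
    \<open>m \<le> n\<close> enters, through
    \<open>m - 1 \<le> n - 1 < n - 2 * \<epsilon>\<close>.\<close>
  have "1 / ?n < \<beta>"
  proof -
    have "?m - 1 < ?n - 2 * \<epsilon>" "0 < ?m - 1" using n2 \<epsilon> by linarith+
    then have "1 < (?n - 2 * \<epsilon>) / (?m - 1)" by simp
    then have "1 / ?n < (?n - 2 * \<epsilon>) / (?m - 1) / ?n"
      using n2 by (intro divide_strict_right_mono) auto
    then show ?thesis by (simp add: \<beta>_def)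
  qed
  then interpret pole_exponents \<gamma> \<beta> \<epsilon> W
    using n2 \<epsilon> by unfold_locales (auto simp: \<gamma>_def W_def add_pos_nonneg intro: order_trans[OF _ less_imp_le])
  have wW: "norm w \<le> W" by (simp add: W_def real_le_rsqrt)
  let ?T = "?Cn ^ 2 * (pole_bound ^ CARD('n)) ^ (CARD('m) - 1) * neg_powr \<epsilon> W * neg_powr \<epsilon> (norm w)"
  have piece: "(\<integral>\<^sup>+X. indicator {0..1} (X \<bullet> e) * (if quadric_grad w X \<bullet> e = 0 then 0
        else quadric_weight w (X - (quadric w X / (quadric_grad w X \<bullet> e)) *\<^sub>R e) /
          ennreal (norm (quadric_grad w (X - (quadric w X / (quadric_grad w X \<bullet> e)) *\<^sub>R e)))) \<partial>lborel)
      \<le> ?Cp * ?Co * ?T" (is "(\<integral>\<^sup>+X. ?h X \<partial>lborel) \<le> _")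
    if e: "e \<in> Basis" for e :: "real ^ 'n ^ 'm"
  proof -
    obtain k i where e: "e = axis k (axis i 1)"
      using e by (auto simp: Basis_vec_def)
    let ?I = "UNIV - {k}"
    let ?P = "\<Pi>\<^sub>M j\<in>?I. lborel :: (real ^ 'n) measure"
    define p where "p x = w - (\<Sum>j\<in>?I. x j)" for x :: "'m \<Rightarrow> real ^ 'n"
    define Q where "Q x = 1 + (\<Sum>j\<in>?I. norm (x j) ^ 2)" for x :: "'m \<Rightarrow> real ^ 'n"
    have "(\<integral>\<^sup>+X. ?h X \<partial>lborel) = (\<integral>\<^sup>+x. (\<integral>\<^sup>+z. ?h (vec_lambda (x(k := z))) \<partial>lborel) \<partial>?P)"
      by (rule nn_integral_vec_split) measurable
    also have "\<dots> \<le> (\<integral>\<^sup>+x. (\<Prod>j\<in>?I. weight (x j)) * (?Cp *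
        (neg_powr \<epsilon> (norm (p x) ^ 2 - Q x) * neg_powr (CARD('n) / 2 - \<epsilon>) (norm (p x) ^ 2 + Q x))) \<partial>?P)"
      unfolding e p_def Q_def using m n \<epsilon> by (intro nn_integral_mono nn_integral_block_le) auto
    also have "\<dots> \<le> (\<integral>\<^sup>+x. ?Cp * ?Co * ((\<Prod>j\<in>?I. vpole (x j)) * neg_powr \<epsilon> (norm (p x) ^ 2 - Q x)) \<partial>?P)"
    proof (rule nn_integral_mono)
      fix x :: "'m \<Rightarrow> real ^ 'n"
      have "(\<Prod>j\<in>?I. weight (x j)) * neg_powr (CARD('n) / 2 - \<epsilon>) (norm (p x) ^ 2 + Q x)
          \<le> ?Co * (\<Prod>j\<in>?I. vpole (x j))"
        unfolding p_def Q_def using m n by (intro outer_weights_le) (auto simp: \<gamma>_def \<beta>_def W_def of_nat_diff)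
      then have "?Cp * neg_powr \<epsilon> (norm (p x) ^ 2 - Q x) *
          ((\<Prod>j\<in>?I. weight (x j)) * neg_powr (CARD('n) / 2 - \<epsilon>) (norm (p x) ^ 2 + Q x))
          \<le> ?Cp * neg_powr \<epsilon> (norm (p x) ^ 2 - Q x) * (?Co * (\<Prod>j\<in>?I. vpole (x j)))"
        by (rule mult_left_mono) simp
      then show "(\<Prod>j\<in>?I. weight (x j)) * (?Cp *
          (neg_powr \<epsilon> (norm (p x) ^ 2 - Q x) * neg_powr (CARD('n) / 2 - \<epsilon>) (norm (p x) ^ 2 + Q x)))
          \<le> ?Cp * ?Co * ((\<Prod>j\<in>?I. vpole (x j)) * neg_powr \<epsilon> (norm (p x) ^ 2 - Q x))"
        by (simp only: ac_simps)
    qed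
    also have "\<dots> = ?Cp * ?Co * (\<integral>\<^sup>+x. (\<Prod>j\<in>?I. vpole (x j)) * neg_powr \<epsilon> (norm (p x) ^ 2 - Q x) \<partial>?P)"
      unfolding p_def Q_def by (rule nn_integral_cmult) measurable
    also have "(\<integral>\<^sup>+x. (\<Prod>j\<in>?I. vpole (x j)) * neg_powr \<epsilon> (norm (p x) ^ 2 - Q x) \<partial>?P) \<le> ?T"
    proof -
      \<comment> \<open>Since \<open>2 \<le> m\<close>, a second block \<open>k'\<close> exists to
        integrate out the singular factor left by block \<open>k\<close>.\<close>
      have "card ?I \<noteq> 0" using m by (simp add: card_Diff_singleton)
      then obtain k' where k': "k' \<in> ?I" by (metis card.empty ex_in_conv)
      define K where "K = ?I - {k'}"
      have K: "finite K" "k' \<notin> K" "?I = insert k' K" using k' by (auto simp: K_def)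
      then have "Suc (card K) = CARD('m) - 1"
        by (metis card_insert_disjoint card_Diff_singleton UNIV_I)
      then show ?thesis
        using nn_integral_vpoles_affine_le[OF K(1,2) wW] unfolding p_def Q_def K(3) by simp
    qed
    finally show ?thesis by (simp add: mult_left_mono)
  qed
  have "delta_integral (quadric w :: real ^ 'n ^ 'm \<Rightarrow> real) (quadric_weight w)
      \<le> ?C0 * (\<Sum>e\<in>(Basis :: (real ^ 'n ^ 'm) set). ?Cp * ?Co * ?T)"
  proof (rule order_trans[OF delta_integral_le_sum_graphs[OF GDERIV_quadric quadric_diff
          quadric_grad_diag quadric_grad_nonzero]], goal_cases)
    \<comment> \<open>The comparison of the sums; the other goals are the side conditions.\<close>
    case 6
    show ?case by (intro mult_left_mono sum_mono piece) simp_all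
  qed simp_all
  also have "\<dots> = ?C0 * (of_nat DIM(real ^ 'n ^ 'm) * (?Cp * ?Co * ?T))"
    by simp
  finally have le: "?w * delta_integral (quadric w :: real ^ 'n ^ 'm \<Rightarrow> real) (quadric_weight w)
      \<le> ?w * (?C0 * (of_nat DIM(real ^ 'n ^ 'm) * (?Cp * ?Co * ?T)))"
    by (rule mult_left_mono) simp
  have "?w * (neg_powr (CARD('n) * (CARD('m) - 1) * (\<gamma> + \<beta> - 1)) W * neg_powr \<epsilon> W * neg_powr \<epsilon> (norm w)) \<le> 1"
  proof -
    define N where "N = CARD('n) + 1 - CARD('m)"
    have N: "real N = ?n + 1 - ?m" using n by (simp add: N_def of_nat_diff)
    \<comment> \<open>The balance of exponents: \<open>n * (m - 1) * (\<gamma> + \<beta> - 1) = n -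
      2 * \<epsilon> - (m - 1)\<close>. The two factors of order \<open>\<epsilon>\<close>, in
      \<open>W\<close> and in \<open>norm w\<close>, then raise the total to
      \<open>n + 1 - m\<close>, the exponent of the prefactor.\<close>
    have "CARD('n) * (CARD('m) - 1) * (\<gamma> + \<beta> - 1) + \<epsilon> = real N - \<epsilon>"
    proof -
      have "?n * (?m - 1) * \<beta> = ?n - 2 * \<epsilon>" using n2 by (simp add: \<beta>_def)
      moreover have "?n * (?m - 1) * (\<gamma> - 1) = - (?m - 1)" using n2 by (simp add: \<gamma>_def)
      ultimately have "?n * (?m - 1) * (\<gamma> + \<beta> - 1) = ?n - 2 * \<epsilon> - (?m - 1)"
        by (simp add: algebra_simps)
      then show ?thesis using m by (simp add: N of_nat_diff)
    qed
    then have "neg_powr (CARD('n) * (CARD('m) - 1) * (\<gamma> + \<beta> - 1)) W * neg_powr \<epsilon> W = neg_powr (real N - \<epsilon>) W"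
      by (simp only: neg_powr_add[symmetric])
    also have "\<dots> \<le> neg_powr (real N - \<epsilon>) (norm w)"
      using wW N n2 \<epsilon> by (intro neg_powr_antimono) auto
    finally have "neg_powr (CARD('n) * (CARD('m) - 1) * (\<gamma> + \<beta> - 1)) W * neg_powr \<epsilon> W * neg_powr \<epsilon> (norm w)
        \<le> neg_powr (real N - \<epsilon>) (norm w) * neg_powr \<epsilon> (norm w)"
      by (rule mult_right_mono) simp
    also have "\<dots> = neg_powr (real N) (norm w)"
      by (simp flip: neg_powr_add)
    finally have "?w * (neg_powr (CARD('n) * (CARD('m) - 1) * (\<gamma> + \<beta> - 1)) W * neg_powr \<epsilon> W * neg_powr \<epsilon> (norm w))
        \<le> ?w * neg_powr (real N) (norm w)"
      by (rule mult_left_mono) simp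
    also have "\<dots> = 1"
      unfolding N_def[symmetric] using False
      by (simp add: neg_powr_eq ennreal_mult[symmetric] powr_minus powr_realpow)
    finally show ?thesis .
  qed
  then have "?CJ * (?w * (neg_powr (CARD('n) * (CARD('m) - 1) * (\<gamma> + \<beta> - 1)) W * neg_powr \<epsilon> W * neg_powr \<epsilon> (norm w)))
      \<le> ?CJ * 1"
    by (rule mult_left_mono) simp
  moreover have "(pole_bound ^ CARD('n)) ^ (CARD('m) - 1)
      = ?CJ * neg_powr (CARD('n) * (CARD('m) - 1) * (\<gamma> + \<beta> - 1)) W"
    unfolding power_mult[symmetric] pole_bound_def power_mult_distrib
    using m by (subst neg_powr_power) auto
  ultimately have "?w * ((pole_bound ^ CARD('n)) ^ (CARD('m) - 1) * neg_powr \<epsilon> W * neg_powr \<epsilon> (norm w)) \<le> ?CJ"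
    by (simp add: ac_simps)
  then have "?C0 * (of_nat DIM(real ^ 'n ^ 'm) * (?Cp * ?Co * (?Cn ^ 2 *
      (?w * ((pole_bound ^ CARD('n)) ^ (CARD('m) - 1) * neg_powr \<epsilon> W * neg_powr \<epsilon> (norm w))))))
    \<le> ?C0 * (of_nat DIM(real ^ 'n ^ 'm) * (?Cp * ?Co * (?Cn ^ 2 * ?CJ)))"
    by (intro mult_left_mono) auto
  then show ?thesis
    using le by (simp only: ac_simps)
qed

lemma delta_integral_quadric_bounded:
  assumes "2 \<le> CARD('m)" "CARD('m) \<le> CARD('n)"
  shows "(SUP w :: real ^ 'n. ennreal (norm w ^ (CARD('n) + 1 - CARD('m))) *
    delta_integral (quadric w :: real ^ 'n ^ 'm \<Rightarrow> real) (quadric_weight w)) < top"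
  by (rule le_less_trans[OF SUP_least[OF delta_integral_quadric_le[OF assms]]])
     (simp add: ennreal_mult_less_top power_less_top_ennreal ennreal_of_nat_eq_real_of_nat)

section \<open>The two functions as instances of the general bound\<close>

lemma Lambda_eq:
  "Lambda TYPE('m::finite) (w :: real ^ 'n) = ennreal (norm w ^ 2) *
    delta_integral (quadric w :: real ^ 'n ^ 'm \<Rightarrow> real) (quadric_weight w)"
  unfolding Lambda_def quadric_def[abs_def] quadric_weight_def[abs_def] ..

text \<open>The pair \<open>(x, z)\<close> is identified with a vector of two blocks through the
  linear isometry \<open>h\<close>; under it the constraint and the weights become
  \<open>quadric\<close> and \<open>quadric_weight\<close> with two blocks.\<close>

lemma Delta_le:
  fixes w :: "real ^ 'n"
  shows "Delta w \<le> ennreal (norm w ^ (CARD('n) - 1)) *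
    delta_integral (quadric w :: real ^ 'n ^ 2 \<Rightarrow> real) (quadric_weight w)"
proof -
  define F where "F = (\<lambda>(x :: real ^ 'n, z :: real ^ 'n). 1 + norm z ^ 2 + norm x ^ 2 - norm (w - x - z) ^ 2)"
  define G where "G = (\<lambda>(x :: real ^ 'n, z :: real ^ 'n). (2 *\<^sub>R (w - z), 2 *\<^sub>R (w - x)))"
  define g where "g = (\<lambda>(x, z). weight x * weight (w - x - z) * weight (z :: real ^ 'n))"
  define h where "h X = (X $ 1, X $ 2)" for X :: "real ^ 'n ^ 2"
  define k :: "_ \<Rightarrow> real ^ 'n ^ 2" where "k = (\<lambda>(x, z). \<chi> j. if j = 1 then x else z)"
  have [measurable]: "F \<in> borel_measurable borel" "G \<in> borel_measurable borel" "g \<in> borel_measurable borel"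
    unfolding F_def G_def g_def borel_prod[symmetric] by measurable
  have deriv: "GDERIV F X :> G X" for X
    unfolding gderiv_def F_def G_def power2_norm_eq_inner split_def
    apply (rule derivative_eq_intros refl)+
    by (simp add: fun_eq_iff inner_prod_def inner_simps inner_commute algebra_simps)
  have "delta_integral F g \<le> delta_integral (F \<circ> h) (g \<circ> h)"
  proof (rule delta_integral_isometry_le[where k = k and G = G])
    show "linear h" by (rule linearI) (simp_all add: h_def)
    show "norm (h X) = norm X" for X
      by (simp add: h_def norm_prod_def norm_vec_def L2_set_def sum_2)
    show "h (k y) = y" for y by (simp add: h_def k_def split_def)
  qed (use deriv in auto)
  also have "F \<circ> h = quadric w"
    by (simp add: F_def h_def fun_eq_iff quadric_def sum_2 diff_diff_eq)
  also have "g \<circ> h = quadric_weight w"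
    by (simp add: g_def h_def fun_eq_iff quadric_weight_def sum_2 UNIV_2 diff_diff_eq ac_simps)
  finally show ?thesis
    unfolding Delta_def F_def g_def by (intro mult_left_mono) auto
qed

theorem theorem1:
  shows "(CARD('n::finite) \<ge> 3 \<and> CARD('m::finite) + 1 = CARD('n) \<longrightarrow>
            (SUP w :: real ^ 'n. Lambda TYPE('m) w) < \<infinity>) \<and>
         (CARD('n) \<ge> 2 \<longrightarrow> (SUP w :: real ^ 'n. Delta w) < \<infinity>)"
proof (intro conjI impI)
  assume "CARD('n) \<ge> 3 \<and> CARD('m) + 1 = CARD('n)"
  \<comment> \<open>With \<open>m = n - 1\<close> the general exponent \<open>n + 1 - m\<close> is
    2, and \<open>n \<ge> 3\<close> gives the two blocks required.\<close>
  then have "2 \<le> CARD('m)" "CARD('m) \<le> CARD('n)" "CARD('n) + 1 - CARD('m) = 2"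
    by auto
  then show "(SUP w :: real ^ 'n. Lambda TYPE('m) w) < \<infinity>"
    using delta_integral_quadric_bounded[where 'm = 'm and 'n = 'n] by (simp add: Lambda_eq)
next
  assume "CARD('n) \<ge> 2"
  \<comment> \<open>Here \<open>m = 2\<close>, so the general exponent is
    \<open>n - 1\<close>.\<close>
  then have "(SUP w :: real ^ 'n. ennreal (norm w ^ (CARD('n) - 1)) *
      delta_integral (quadric w :: real ^ 'n ^ 2 \<Rightarrow> real) (quadric_weight w)) < \<infinity>"
    using delta_integral_quadric_bounded[where 'm = 2 and 'n = 'n] by simp
  moreover have "(SUP w :: real ^ 'n. Delta w) \<le> (SUP w :: real ^ 'n. ennreal (norm w ^ (CARD('n) - 1)) *
      delta_integral (quadric w :: real ^ 'n ^ 2 \<Rightarrow> real) (quadric_weight w))"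
    by (intro SUP_mono') (rule Delta_le)
  ultimately show "(SUP w :: real ^ 'n. Delta w) < \<infinity>"
    by (rule le_less_trans[rotated])
qed

end
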